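(* Let $K$ be a field, $\lambda\in K$. Let $(M,\triangleright,\triangleleft,\rho,\varphi)$ be a $\lambda$-inf-Hopf bimodule over a $\lambda$-inf-bialgebra $(A,\mu,\Delta)$. Let $\alpha_A,\beta_A,\psi_A,\omega_A:A\to A$ be morphisms of algebras and coalgebras such that any two of them commute, and let $\alpha_M,\beta_M,\psi_M,\omega_M:M\to M$ be linear maps such that any two of them commute and, for each $f\in\{\alpha,\beta,\psi,\omega\}$, $a\in A$, $m\in M$, $$f_M(a\triangleright m)=f_A(a)\triangleright f_M(m),\quad f_M(m\triangleleft a)=f_M(m)\triangleleft f_A(a),\quad \rho f_M=(f_A\otimes f_M)\rho,\quad \varphi f_M=(f_M\otimes f_A)\varphi.$$ Then $$\big(M,\ \triangleright\circ(\alpha_A\otimes\beta_M),\ \triangleleft\circ(\alpha_M\otimes\beta_A),\ (\omega_A\otimes\psi_M)\circ\rho,\ (\omega_M\otimes\psi_A)\circ\varphi,\ \alpha_M,\beta_M,\psi_M,\omega_M\big)$$ is a $\lambda$-infBH-Hopf bimodule over the $\lambda$-infBH-bialgebra $(A,\ \mu\circ(\alpha_A\otimes\beta_A),\ (\omega_A\otimes\psi_A)\circ\Delta,\ \alpha_A,\beta_A,\psi_A,\omega_A)$.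
   Context: Everything is over the field $K$; (co)units are not assumed. BiHom-associative algebra $(A,\mu,\alpha,\beta)$: $\mu$ (written $ab$) and $\alpha,\beta$ linear, $\alpha\beta=\beta\alpha$, $\alpha,\beta$ multiplicative, $\alpha(a)(bc)=(ab)\beta(c)$. BiHom-coassociative coalgebra $(C,\Delta,\psi,\omega)$: $\psi\omega=\omega\psi$, $(\psi\otimes\psi)\Delta=\Delta\psi$, $(\omega\otimes\omega)\Delta=\Delta\omega$, $(\Delta\otimes\psi)\Delta=(\omega\otimes\Delta)\Delta$. $\lambda$-infBH-bialgebra $(A,\mu,\Delta,\alpha,\beta,\psi,\omega)$: $(A,\mu,\alpha,\beta)$ BiHom-associative, $(A,\Delta,\psi,\omega)$ BiHom-coassociative, each of $\alpha,\beta$ commutes with each of $\psi,\omega$, $(\alpha\otimes\alpha)\Delta=\Delta\alpha$, $(\beta\otimes\beta)\Delta=\Delta\beta$, $\psi,\omega$ multiplicative, and (with $\Delta(a)=a_1\otimes a_2$) $\Delta(ab)=\omega(a)b_1\otimes\beta(b_2)+\alpha(a_1)\otimes a_2\psi(b)+\lambda\,\alpha\omega(a)\otimes\beta\psi(b)$. A $\lambda$-inf-bialgebra $(A,\mu,\Delta)$ is the case $\alpha=\beta=\psi=\omega=\mathrm{id}$. Bimodule $(M,\triangleright,\triangleleft,\alpha_M,\beta_M)$: $\alpha_M\beta_M=\beta_M\alpha_M$; $f_M(a\triangleright m)=f_A(a)\triangleright f_M(m)$, $f_M(m\triangleleft a)=f_M(m)\triangleleft f_A(a)$ for $f\in\{\alpha,\beta\}$;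 $\alpha_A(a)\triangleright(a'\triangleright m)=(aa')\triangleright\beta_M(m)$; $\alpha_M(m)\triangleleft(aa')=(m\triangleleft a)\triangleleft\beta_A(a')$; $\alpha_A(a)\triangleright(m\triangleleft a')=(a\triangleright m)\triangleleft\beta_A(a')$. Bicomodule $(M,\rho,\varphi,\psi_M,\omega_M)$, $\rho:M\to A\otimes M$, $\varphi:M\to M\otimes A$: $\psi_M\omega_M=\omega_M\psi_M$; $(g_A\otimes g_M)\rho=\rho g_M$, $(g_M\otimes g_A)\varphi=\varphi g_M$ for $g\in\{\psi,\omega\}$; $(\omega_A\otimes\rho)\rho=(\Delta\otimes\psi_M)\rho$; $(\omega_M\otimes\Delta)\varphi=(\varphi\otimes\psi_A)\varphi$; $(\omega_A\otimes\varphi)\rho=(\rho\otimes\psi_A)\varphi$. $\lambda$-infBH-Hopf bimodule $(M,\triangleright,\triangleleft,\rho,\varphi,\alpha_M,\beta_M,\psi_M,\omega_M)$: any two of $\alpha_M,\beta_M,\psi_M,\omega_M$ commute; it is a bimodule and a bicomodule; and, writing $\rho(m)=m_{(-1)}\otimes m_{(0)}$, $\varphi(m)=m_{(0)}\otimes m_{(1)}$, $\rho(a\triangleright m)=\omega_A(a)m_{(-1)}\otimes\beta_M(m_{(0)})+\alpha_A(a_1)\otimes a_2\triangleright\psi_M(m)+\lambda\,\alpha_A\omega_A(a)\otimes\beta_M\psi_M(m)$, $\varphi(m\triangleleft a)=\omega_M(m)\triangleleft a_1\otimes\beta_A(a_2)+\alpha_M(m_{(0)})\otimes m_{(1)}\psi_A(a)+\lambda\,\alpha_M\omega_M(m)\otimes\beta_A\psi_A(a)$,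 $\varphi(a\triangleright m)=\omega_A(a)\triangleright m_{(0)}\otimes\beta_A(m_{(1)})$, $\rho(m\triangleleft a)=\alpha_A(m_{(-1)})\otimes m_{(0)}\triangleleft\psi_A(a)$. A $\lambda$-inf-Hopf bimodule $(M,\triangleright,\triangleleft,\rho,\varphi)$ is the case where all eight structure maps are identities. *)

theory Defs
  imports Complex_Main "HOL-Library.Poly_Mapping" "HOL-Library.Set_Algebras"
begin

section \<open>Tensor products over a field\<close>

text \<open>
  A vector space over the field \<open>'k\<close> is a type together with a scalar multiplication satisfying
  \<^locale>\<open>vector_space\<close>. As the scalar multiplication is not determined by the type, a tensor product
  cannot be a type of its own: it is built as the quotient of the free vector space on the tuples,
  \<open>'a \<times> 'b \<Rightarrow>\<^sub>0 'k\<close>, by the subspace of multilinearity relations. Its elements are the cosets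
  \<open>x +o N\<close> of that subspace \<open>N\<close>, and cosets are added with the set addition of
  \<^theory>\<open>HOL-Library.Set_Algebras\<close>.
\<close>

definition free_scale :: "'k::field \<Rightarrow> ('x \<Rightarrow>\<^sub>0 'k) \<Rightarrow> ('x \<Rightarrow>\<^sub>0 'k)" where
  "free_scale c x = Poly_Mapping.map ((*) c) x"

definition quotient_space :: "('x \<Rightarrow>\<^sub>0 'k::field) set \<Rightarrow> ('x \<Rightarrow>\<^sub>0 'k) set set" where
  "quotient_space N = range (\<lambda>x. x +o N)"

text \<open>The summand \<open>N\<close> matters only for \<open>c = 0\<close>.\<close>

definition coset_scale :: "('x \<Rightarrow>\<^sub>0 'k::field) set \<Rightarrow> 'k \<Rightarrow> ('x \<Rightarrow>\<^sub>0 'k) set \<Rightarrow> ('x \<Rightarrow>\<^sub>0 'k) set" where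
  "coset_scale N c X = free_scale c ` X + N"

definition linear_into ::
    "('k::field \<Rightarrow> 'a \<Rightarrow> 'a::ab_group_add) \<Rightarrow> ('x \<Rightarrow>\<^sub>0 'k) set \<Rightarrow> ('a \<Rightarrow> ('x \<Rightarrow>\<^sub>0 'k) set) \<Rightarrow> bool" where
  "linear_into s N D \<longleftrightarrow>
     (\<forall>x. D x \<in> quotient_space N) \<and>
     (\<forall>x y. D (x + y) = D x + D y) \<and>
     (\<forall>c x. D (s c x) = coset_scale N c (D x))"

text \<open>
  \<open>coset_lift N h\<close> is the linear map into the quotient by \<open>N\<close> with value \<open>h k\<close> on the class
  of the basis vector \<open>k\<close>; the sum is one of cosets, and adding \<open>N\<close> is needed for the empty sum.
\<close>

definition coset_lift ::
    "('y \<Rightarrow>\<^sub>0 'k::field) set \<Rightarrow> ('x \<Rightarrow> ('y \<Rightarrow>\<^sub>0 'k) set) \<Rightarrow> ('x \<Rightarrow>\<^sub>0 'k) set \<Rightarrow> ('y \<Rightarrow>\<^sub>0 'k) set" where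
  "coset_lift N h X =
     (\<Union>x\<in>X. (\<Sum>k\<in>Poly_Mapping.keys x. free_scale (Poly_Mapping.lookup x k) ` h k) + N)"

abbreviation basis_vec :: "'x \<Rightarrow> ('x \<Rightarrow>\<^sub>0 'k::field)" where
  "basis_vec k \<equiv> Poly_Mapping.single k 1"

definition tensor_null ::
    "('k::field \<Rightarrow> 'a \<Rightarrow> 'a::ab_group_add) \<Rightarrow> ('k \<Rightarrow> 'b \<Rightarrow> 'b::ab_group_add) \<Rightarrow> ('a \<times> 'b \<Rightarrow>\<^sub>0 'k) set" where
  "tensor_null s1 s2 = module.span free_scale
     ({basis_vec (a + a', b) - basis_vec (a, b) - basis_vec (a', b) | a a' b. True} \<union>
      {basis_vec (a, b + b') - basis_vec (a, b) - basis_vec (a, b') | a b b'. True} \<union>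
      {basis_vec (s1 c a, b) - free_scale c (basis_vec (a, b)) | c a b. True} \<union>
      {basis_vec (a, s2 c b) - free_scale c (basis_vec (a, b)) | c a b. True})"

definition tensor ::
    "('k::field \<Rightarrow> 'a \<Rightarrow> 'a::ab_group_add) \<Rightarrow> ('k \<Rightarrow> 'b \<Rightarrow> 'b::ab_group_add) \<Rightarrow>
     'a \<Rightarrow> 'b \<Rightarrow> ('a \<times> 'b \<Rightarrow>\<^sub>0 'k) set" where
  "tensor s1 s2 a b = basis_vec (a, b) +o tensor_null s1 s2"

text \<open>
  The threefold tensor product, identified with both bracketings of the iterated one.
\<close>

definition tensor3_null ::
    "('k::field \<Rightarrow> 'a \<Rightarrow> 'a::ab_group_add) \<Rightarrow> ('k \<Rightarrow> 'b \<Rightarrow> 'b::ab_group_add) \<Rightarrow>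
     ('k \<Rightarrow> 'c \<Rightarrow> 'c::ab_group_add) \<Rightarrow> ('a \<times> 'b \<times> 'c \<Rightarrow>\<^sub>0 'k) set" where
  "tensor3_null s1 s2 s3 = module.span free_scale
     ({basis_vec (a + a', b, c) - basis_vec (a, b, c) - basis_vec (a', b, c) | a a' b c. True} \<union>
      {basis_vec (a, b + b', c) - basis_vec (a, b, c) - basis_vec (a, b', c) | a b b' c. True} \<union>
      {basis_vec (a, b, c + c') - basis_vec (a, b, c) - basis_vec (a, b, c') | a b c c'. True} \<union>
      {basis_vec (s1 r a, b, c) - free_scale r (basis_vec (a, b, c)) | r a b c. True} \<union>
      {basis_vec (a, s2 r b, c) - free_scale r (basis_vec (a, b, c)) | r a b c. True} \<union>
      {basis_vec (a, b, s3 r c) - free_scale r (basis_vec (a, b, c)) | r a b c. True})"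

definition tensor3 ::
    "('k::field \<Rightarrow> 'a \<Rightarrow> 'a::ab_group_add) \<Rightarrow> ('k \<Rightarrow> 'b \<Rightarrow> 'b::ab_group_add) \<Rightarrow>
     ('k \<Rightarrow> 'c \<Rightarrow> 'c::ab_group_add) \<Rightarrow> 'a \<Rightarrow> 'b \<Rightarrow> 'c \<Rightarrow> ('a \<times> 'b \<times> 'c \<Rightarrow>\<^sub>0 'k) set" where
  "tensor3 s1 s2 s3 a b c = basis_vec (a, b, c) +o tensor3_null s1 s2 s3"

text \<open>
  Tensor products of linear maps. The scalar multiplications given as arguments are those of the
  codomain: \<open>tensor_map s1 s2 f g\<close> is \<open>f \<otimes> g\<close>; \<open>tensor_map_left s1 s2 s3 D g\<close> is \<open>D \<otimes> g\<close> for \<open>D\<close>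
  with values in a twofold tensor product; \<open>tensor_map_right s1 s2 s3 f D\<close> is \<open>f \<otimes> D\<close> for such \<open>D\<close>.
\<close>

definition tensor_map ::
    "('k::field \<Rightarrow> 'c \<Rightarrow> 'c::ab_group_add) \<Rightarrow> ('k \<Rightarrow> 'd \<Rightarrow> 'd::ab_group_add) \<Rightarrow>
     ('a \<Rightarrow> 'c) \<Rightarrow> ('b \<Rightarrow> 'd) \<Rightarrow> ('a \<times> 'b \<Rightarrow>\<^sub>0 'k) set \<Rightarrow> ('c \<times> 'd \<Rightarrow>\<^sub>0 'k) set" where
  "tensor_map s1 s2 f g = coset_lift (tensor_null s1 s2) (\<lambda>(a, b). tensor s1 s2 (f a) (g b))"

definition tensor_map_left ::
    "('k::field \<Rightarrow> 'c \<Rightarrow> 'c::ab_group_add) \<Rightarrow> ('k \<Rightarrow> 'd \<Rightarrow> 'd::ab_group_add) \<Rightarrow>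
     ('k \<Rightarrow> 'e \<Rightarrow> 'e::ab_group_add) \<Rightarrow> ('a \<Rightarrow> ('c \<times> 'd \<Rightarrow>\<^sub>0 'k) set) \<Rightarrow> ('b \<Rightarrow> 'e) \<Rightarrow>
     ('a \<times> 'b \<Rightarrow>\<^sub>0 'k) set \<Rightarrow> ('c \<times> 'd \<times> 'e \<Rightarrow>\<^sub>0 'k) set" where
  "tensor_map_left s1 s2 s3 D g = coset_lift (tensor3_null s1 s2 s3)
     (\<lambda>(a, b). coset_lift (tensor3_null s1 s2 s3) (\<lambda>(x, y). tensor3 s1 s2 s3 x y (g b)) (D a))"

definition tensor_map_right ::
    "('k::field \<Rightarrow> 'c \<Rightarrow> 'c::ab_group_add) \<Rightarrow> ('k \<Rightarrow> 'd \<Rightarrow> 'd::ab_group_add) \<Rightarrow>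
     ('k \<Rightarrow> 'e \<Rightarrow> 'e::ab_group_add) \<Rightarrow> ('a \<Rightarrow> 'c) \<Rightarrow> ('b \<Rightarrow> ('d \<times> 'e \<Rightarrow>\<^sub>0 'k) set) \<Rightarrow>
     ('a \<times> 'b \<Rightarrow>\<^sub>0 'k) set \<Rightarrow> ('c \<times> 'd \<times> 'e \<Rightarrow>\<^sub>0 'k) set" where
  "tensor_map_right s1 s2 s3 f D = coset_lift (tensor3_null s1 s2 s3)
     (\<lambda>(a, b). coset_lift (tensor3_null s1 s2 s3) (\<lambda>(x, y). tensor3 s1 s2 s3 (f a) x y) (D b))"

definition bilinear_map ::
    "('k::field \<Rightarrow> 'a \<Rightarrow> 'a::ab_group_add) \<Rightarrow> ('k \<Rightarrow> 'b \<Rightarrow> 'b::ab_group_add) \<Rightarrow>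
     ('k \<Rightarrow> 'c \<Rightarrow> 'c::ab_group_add) \<Rightarrow> ('a \<Rightarrow> 'b \<Rightarrow> 'c) \<Rightarrow> bool" where
  "bilinear_map s1 s2 s3 h \<longleftrightarrow>
     (\<forall>a. Vector_Spaces.linear s2 s3 (h a)) \<and> (\<forall>b. Vector_Spaces.linear s1 s3 (\<lambda>a. h a b))"

definition pairwise_commute :: "('a \<Rightarrow> 'a) set \<Rightarrow> bool" where
  "pairwise_commute F \<longleftrightarrow> (\<forall>f\<in>F. \<forall>g\<in>F. f \<circ> g = g \<circ> f)"


subsection \<open>Adequacy of the tensor product\<close>

lemma lookup_free_scale: "Poly_Mapping.lookup (free_scale c x) k = c * Poly_Mapping.lookup x k"
  unfolding free_scale_def by (simp add: Poly_Mapping.map.rep_eq when_def)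

lemma vector_space_free_scale: "vector_space free_scale"
  by standard (auto intro!: poly_mapping_eqI simp: lookup_free_scale lookup_add algebra_simps)

interpretation free: vector_space free_scale
  by (rule vector_space_free_scale)

definition linear_extension ::
    "('k::field \<Rightarrow> 'v \<Rightarrow> 'v::ab_group_add) \<Rightarrow> ('x \<Rightarrow> 'v) \<Rightarrow> ('x \<Rightarrow>\<^sub>0 'k) \<Rightarrow> 'v" where
  "linear_extension s r x = (\<Sum>k\<in>Poly_Mapping.keys x. s (Poly_Mapping.lookup x k) (r k))"

lemma linear_extension_superset:
  assumes "vector_space s" "finite F" "Poly_Mapping.keys x \<subseteq> F"
  shows "linear_extension s r x = (\<Sum>k\<in>F. s (Poly_Mapping.lookup x k) (r k))"
proof -
  interpret vector_space s by fact
  show ?thesis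
    unfolding linear_extension_def using assms(2,3)
    by (intro sum.mono_neutral_left) (auto simp: in_keys_iff)
qed

lemma linear_linear_extension:
  assumes "vector_space s"
  shows "Vector_Spaces.linear free_scale s (linear_extension s r)"
proof -
  interpret vector_space s by fact
  have add: "linear_extension s r (x + y) = linear_extension s r x + linear_extension s r y" for x y
  proof -
    let ?F = "Poly_Mapping.keys x \<union> Poly_Mapping.keys y"
    have "linear_extension s r z = (\<Sum>k\<in>?F. s (Poly_Mapping.lookup z k) (r k))"
      if "Poly_Mapping.keys z \<subseteq> ?F" for z
      by (rule linear_extension_superset) (use assms that in auto)
    then show ?thesis
      using Poly_Mapping.keys_add[of x y]
      by (simp add: lookup_add scale_left_distrib sum.distrib)
  qed
  have scale: "linear_extension s r (free_scale c x) = s c (linear_extension s r x)" for c x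
  proof -
    have "Poly_Mapping.keys (free_scale c x) \<subseteq> Poly_Mapping.keys x"
      by (auto simp: in_keys_iff lookup_free_scale)
    then have "linear_extension s r (free_scale c x) =
        (\<Sum>k\<in>Poly_Mapping.keys x. s (Poly_Mapping.lookup (free_scale c x) k) (r k))"
      by (intro linear_extension_superset) (use assms in auto)
    then show ?thesis
      by (simp add: linear_extension_def lookup_free_scale scale_sum_right)
  qed
  show ?thesis
    by (simp add: Vector_Spaces.linear_iff vector_space_free_scale assms add scale)
qed

lemma linear_extension_basis:
  assumes "vector_space s"
  shows "linear_extension s r (basis_vec k) = r k"
proof -
  interpret vector_space s by fact
  show ?thesis by (simp add: linear_extension_def)
qed

lemma coset_eq_iff:
  assumes "free.subspace N"
  shows "x +o N = y +o N \<longleftrightarrow> x - y \<in> N"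
proof
  assume "x +o N = y +o N"
  moreover have "x \<in> x +o N"
    using free.subspace_0[OF assms] by (force simp: elt_set_plus_def)
  ultimately show "x - y \<in> N" by (auto simp: elt_set_plus_def)
next
  assume d: "x - y \<in> N"
  have "\<exists>b\<in>N. x + n = y + b" if "n \<in> N" for n
    by (rule bexI[of _ "(x - y) + n"]) (use d that free.subspace_add[OF assms] in auto)
  moreover have "\<exists>b\<in>N. y + n = x + b" if "n \<in> N" for n
    by (rule bexI[of _ "n - (x - y)"]) (use d that free.subspace_diff[OF assms] in auto)
  ultimately show "x +o N = y +o N" by (auto simp: elt_set_plus_def)
qed

lemma subspace_plus_self:
  assumes "free.subspace N"
  shows "N + N = N"
  using free.subspace_add[OF assms] free.subspace_0[OF assms]
  by (auto simp: set_plus_def) (metis add_0)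

lemma coset_plus:
  assumes "free.subspace N"
  shows "(x +o N) + (y +o N) = (x + y) +o N"
  by (simp add: set_plus_rearrange subspace_plus_self[OF assms])

lemma coset_scale_coset:
  assumes "free.subspace N"
  shows "coset_scale N c (x +o N) = free_scale c x +o N"
proof -
  have "free_scale c x + n \<in> free_scale c ` (x +o N) + N" if "n \<in> N" for n
  proof (rule set_plus_intro)
    show "free_scale c x \<in> free_scale c ` (x +o N)"
      using free.subspace_0[OF assms] by (force simp: elt_set_plus_def)
  qed (fact that)
  moreover have "free_scale c (x + m) + n \<in> free_scale c x +o N" if "m \<in> N" "n \<in> N" for m n
    using that free.subspace_add[OF assms] free.subspace_scale[OF assms]
    by (force simp: elt_set_plus_def free.scale_right_distrib add.assoc)
  ultimately show ?thesis
    unfolding coset_scale_def by (auto simp: elt_set_plus_def set_plus_def)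
qed

lemma coset_lift_summand:
  assumes N: "free.subspace N" and F: "finite F"
  shows "(\<Sum>k\<in>F. free_scale (c k) ` (r k +o N)) + N = (\<Sum>k\<in>F. free_scale (c k) (r k)) +o N"
  using F
proof (induction F)
  case empty
  then show ?case by (auto simp: elt_set_plus_def set_plus_def)
next
  case (insert k F)
  have "(\<Sum>k\<in>insert k F. free_scale (c k) ` (r k +o N)) + N
      = (free_scale (c k) ` (r k +o N) + N) + ((\<Sum>k\<in>F. free_scale (c k) ` (r k +o N)) + N)"
  proof -
    have "A + B + N = (A + N) + (B + N)" for A B
    proof -
      have "A + B + N = A + B + (N + N)" by (simp only: subspace_plus_self[OF N])
      then show ?thesis by (simp only: ac_simps)
    qed
    then show ?thesis by (simp only: sum.insert[OF insert.hyps])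
  qed
  also have "\<dots> = (free_scale (c k) (r k) +o N) + ((\<Sum>k\<in>F. free_scale (c k) (r k)) +o N)"
    using coset_scale_coset[OF N, of "c k" "r k"] by (simp only: coset_scale_def insert.IH)
  also have "\<dots> = (\<Sum>k\<in>insert k F. free_scale (c k) (r k)) +o N"
    by (simp only: coset_plus[OF N] sum.insert[OF insert.hyps])
  finally show ?case .
qed

lemma coset_lift_coset:
  fixes R :: "('x \<Rightarrow>\<^sub>0 'k::field) set" and N :: "('y \<Rightarrow>\<^sub>0 'k) set"
  assumes N: "free.subspace N"
    and R: "\<And>x. x \<in> R \<Longrightarrow> linear_extension free_scale r x \<in> N"
  shows "coset_lift N (\<lambda>k. r k +o N) (x +o free.span R) = linear_extension free_scale r x +o N"
proof -
  let ?L = "linear_extension free_scale r"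
  interpret L: Vector_Spaces.linear free_scale free_scale ?L
    by (rule linear_linear_extension[OF vector_space_free_scale])
  have null: "?L y \<in> N" if "y \<in> free.span R" for y
    using that
  proof (induction rule: free.span_induct_alt)
    case base
    then show ?case by (simp add: L.zero free.subspace_0[OF N])
  next
    case (step c x y)
    then show ?case
      by (simp add: L.add L.scale R free.subspace_add[OF N] free.subspace_scale[OF N])
  qed
  have "coset_lift N (\<lambda>k. r k +o N) (x +o free.span R) = (\<Union>y\<in>x +o free.span R. ?L y +o N)"
    unfolding coset_lift_def by (simp add: coset_lift_summand[OF N] linear_extension_def)
  also have "\<dots> = (\<Union>y\<in>x +o free.span R. ?L x +o N)"
  proof (intro SUP_cong refl)
    fix y assume "y \<in> x +o free.span R"
    then show "?L y +o N = ?L x +o N"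
      using null unfolding coset_eq_iff[OF N] by (auto simp: elt_set_plus_def L.add)
  qed
  also have "\<dots> = ?L x +o N"
    using free.span_zero[of R] by (force simp: elt_set_plus_def)
  finally show ?thesis .
qed

lemma subspace_tensor_null: "free.subspace (tensor_null s1 s2)"
  by (simp add: tensor_null_def)

lemma subspace_tensor3_null: "free.subspace (tensor3_null s1 s2 s3)"
  by (simp add: tensor3_null_def)

lemma tensor_bilinear:
  shows "tensor s1 s2 (a + a') b = tensor s1 s2 a b + tensor s1 s2 a' b"
    and "tensor s1 s2 a (b + b') = tensor s1 s2 a b + tensor s1 s2 a b'"
    and "tensor s1 s2 (s1 c a) b = coset_scale (tensor_null s1 s2) c (tensor s1 s2 a b)"
    and "tensor s1 s2 a (s2 c b) = coset_scale (tensor_null s1 s2) c (tensor s1 s2 a b)"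
  unfolding tensor_def coset_plus[OF subspace_tensor_null] coset_scale_coset[OF subspace_tensor_null]
    coset_eq_iff[OF subspace_tensor_null] diff_diff_eq[symmetric]
  unfolding tensor_null_def
  by (intro free.span_base; blast)+

lemma tensor3_trilinear:
  shows "tensor3 s1 s2 s3 (a + a') b d = tensor3 s1 s2 s3 a b d + tensor3 s1 s2 s3 a' b d"
    and "tensor3 s1 s2 s3 a (b + b') d = tensor3 s1 s2 s3 a b d + tensor3 s1 s2 s3 a b' d"
    and "tensor3 s1 s2 s3 a b (d + d') = tensor3 s1 s2 s3 a b d + tensor3 s1 s2 s3 a b d'"
    and "tensor3 s1 s2 s3 (s1 c a) b d = coset_scale (tensor3_null s1 s2 s3) c (tensor3 s1 s2 s3 a b d)"
    and "tensor3 s1 s2 s3 a (s2 c b) d = coset_scale (tensor3_null s1 s2 s3) c (tensor3 s1 s2 s3 a b d)"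
    and "tensor3 s1 s2 s3 a b (s3 c d) = coset_scale (tensor3_null s1 s2 s3) c (tensor3 s1 s2 s3 a b d)"
  unfolding tensor3_def coset_plus[OF subspace_tensor3_null]
    coset_scale_coset[OF subspace_tensor3_null] coset_eq_iff[OF subspace_tensor3_null]
    diff_diff_eq[symmetric]
  unfolding tensor3_null_def
  by (rule free.span_base, simp only: Un_iff mem_Collect_eq disj_assoc,
      ((rule disjI1, intro exI conjI TrueI, rule refl) | (intro exI conjI TrueI, rule refl) |
       rule disjI2)+)+

lemma linear_extension_tensor_null:
  assumes h: "bilinear_map s1 s2 s h" and x: "x \<in> tensor_null s1 s2"
  shows "linear_extension s (\<lambda>(a, b). h a b) x = 0"
proof -
  have lin: "Vector_Spaces.linear s2 s (h a)" "Vector_Spaces.linear s1 s (\<lambda>a. h a b)" for a b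
    using h by (auto simp: bilinear_map_def)
  have vs: "vector_space s"
    using lin(1) by (simp add: Vector_Spaces.linear_iff)
  interpret vector_space s by (fact vs)
  interpret L: Vector_Spaces.linear free_scale s "linear_extension s (\<lambda>(a, b). h a b)"
    by (rule linear_linear_extension[OF vs])
  show ?thesis
    using x unfolding tensor_null_def
  proof (induction rule: free.span_induct_alt)
    case base
    then show ?case by (rule L.zero)
  next
    case (step c x y)
    have "linear_extension s (\<lambda>(a, b). h a b) x = 0"
      using step.hyps lin
      by (auto simp: L.diff L.scale linear_extension_basis[OF vs] Vector_Spaces.linear_iff)
    then show ?case using step by (simp add: L.add L.scale)
  qed
qed

text \<open>The universal property, for an arbitrary bilinear map into a vector space.\<close>

theorem tensor_universal:
  assumes "bilinear_map s1 s2 s h"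
  shows "\<exists>L. (\<forall>a b. L (tensor s1 s2 a b) = h a b) \<and>
             (\<forall>X\<in>quotient_space (tensor_null s1 s2). \<forall>Y\<in>quotient_space (tensor_null s1 s2).
                L (X + Y) = L X + L Y) \<and>
             (\<forall>c. \<forall>X\<in>quotient_space (tensor_null s1 s2).
                L (coset_scale (tensor_null s1 s2) c X) = s c (L X))"
proof -
  let ?N = "tensor_null s1 s2" and ?E = "linear_extension s (\<lambda>(a, b). h a b)"
  have vs: "vector_space s"
    using assms by (simp add: bilinear_map_def Vector_Spaces.linear_iff)
  interpret E: Vector_Spaces.linear free_scale s ?E
    by (rule linear_linear_extension[OF vs])
  define L where "L X = ?E (SOME x. x \<in> X)" for X
  have L: "L (x +o ?N) = ?E x" for x
  proof -
    have "x \<in> x +o ?N"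
      using free.subspace_0[OF subspace_tensor_null] by (force simp: elt_set_plus_def)
    then have "(SOME y. y \<in> x +o ?N) \<in> x +o ?N" by (rule someI)
    then obtain n where "(SOME y. y \<in> x +o ?N) = x + n" "n \<in> ?N" by (auto simp: elt_set_plus_def)
    then show ?thesis
      by (simp add: L_def E.add linear_extension_tensor_null[OF assms])
  qed
  show ?thesis
    by (rule exI[of _ L])
      (auto simp: quotient_space_def tensor_def L linear_extension_basis[OF vs] E.add E.scale
        coset_plus[OF subspace_tensor_null] coset_scale_coset[OF subspace_tensor_null])
qed

theorem tensor_space_induct [consumes 1, case_names zero tensor]:
  assumes "X \<in> quotient_space (tensor_null s1 s2)"
    and zero: "P (tensor_null s1 s2)"
    and tensor: "\<And>c a b Y. Y \<in> quotient_space (tensor_null s1 s2) \<Longrightarrow> P Y \<Longrightarrow>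
                   P (coset_scale (tensor_null s1 s2) c (tensor s1 s2 a b) + Y)"
  shows "P X"
proof -
  let ?N = "tensor_null s1 s2"
  obtain x where X: "X = x +o ?N" using assms(1) by (auto simp: quotient_space_def)
  have x: "linear_extension free_scale basis_vec x = x"
    by (rule poly_mapping_eqI)
      (simp add: linear_extension_def lookup_sum lookup_free_scale lookup_single when_def in_keys_iff
        if_distrib sum.delta cong: if_cong)
  have P: "P ((\<Sum>k\<in>F. free_scale (f k) (basis_vec k)) +o ?N)" if "finite F" for F f
    using that
  proof (induction F)
    case empty
    then show ?case using zero by (simp add: elt_set_plus_def)
  next
    case (insert k F)
    obtain a b where k: "k = (a, b)" by fastforce
    show ?case
      using tensor[OF _ insert.IH, of "f k" a b] insert.hyps
      by (simp add: k quotient_space_def tensor_def coset_scale_coset[OF subspace_tensor_null]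
          coset_plus[OF subspace_tensor_null])
  qed
  show ?thesis
    using P[OF finite_keys, of "Poly_Mapping.lookup x" x] x by (simp add: X linear_extension_def)
qed

lemma tensor_map_tensor:
  assumes f: "Vector_Spaces.linear s1 t1 f" and g: "Vector_Spaces.linear s2 t2 g"
  shows "tensor_map t1 t2 f g (tensor s1 s2 a b) = tensor t1 t2 (f a) (g b)"
proof -
  let ?L = "linear_extension free_scale (\<lambda>k. basis_vec (f (fst k), g (snd k)))"
  let ?N = "tensor_null t1 t2"
  interpret L: Vector_Spaces.linear free_scale free_scale ?L
    by (rule linear_linear_extension[OF vector_space_free_scale])
  have lin: "f (x + y) = f x + f y" "f (s1 c x) = t1 c (f x)"
    "g (x' + y') = g x' + g y'" "g (s2 c x') = t2 c (g x')" for x y x' y' c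
    using f g by (auto simp: Vector_Spaces.linear_iff)
  have eqs: "basis_vec (p + p', q) - basis_vec (p, q) - basis_vec (p', q) \<in> ?N"
    "basis_vec (p, q + q') - basis_vec (p, q) - basis_vec (p, q') \<in> ?N"
    "basis_vec (t1 c p, q) - free_scale c (basis_vec (p, q)) \<in> ?N"
    "basis_vec (p, t2 c q) - free_scale c (basis_vec (p, q)) \<in> ?N" for p p' q q' c
    unfolding tensor_null_def by (intro free.span_base; blast)+
  have "coset_lift ?N (\<lambda>k. basis_vec (f (fst k), g (snd k)) +o ?N) (basis_vec (a, b) +o tensor_null s1 s2)
      = ?L (basis_vec (a, b)) +o ?N"
    unfolding tensor_null_def[of s1 s2]
    by (rule coset_lift_coset[OF subspace_tensor_null])
      (auto simp: L.diff L.scale linear_extension_basis[OF vector_space_free_scale] lin eqs)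
  then show ?thesis
    by (simp add: tensor_map_def tensor_def linear_extension_basis[OF vector_space_free_scale]
        case_prod_unfold)
qed


section \<open>BiHom-algebras, coalgebras and bialgebras\<close>

text \<open>
  Multiplications and actions, that is, linear maps out of a tensor product, are given as bilinear
  maps in curried form.
\<close>

locale bihom_algebra = vector_space s
  for s :: "'k::field \<Rightarrow> 'a \<Rightarrow> 'a::ab_group_add" +
  fixes \<mu> :: "'a \<Rightarrow> 'a \<Rightarrow> 'a" and \<alpha> \<beta> :: "'a \<Rightarrow> 'a"
  assumes mult_bilinear: "bilinear_map s s s \<mu>"
    and alpha_linear: "Vector_Spaces.linear s s \<alpha>"
    and beta_linear: "Vector_Spaces.linear s s \<beta>"
    and alpha_beta: "\<alpha> \<circ> \<beta> = \<beta> \<circ> \<alpha>"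
    and alpha_mult: "\<alpha> (\<mu> a b) = \<mu> (\<alpha> a) (\<alpha> b)"
    and beta_mult: "\<beta> (\<mu> a b) = \<mu> (\<beta> a) (\<beta> b)"
    and bihom_assoc: "\<mu> (\<alpha> a) (\<mu> b c) = \<mu> (\<mu> a b) (\<beta> c)"

locale bihom_coalgebra = vector_space s
  for s :: "'k::field \<Rightarrow> 'a \<Rightarrow> 'a::ab_group_add" +
  fixes \<Delta> :: "'a \<Rightarrow> ('a \<times> 'a \<Rightarrow>\<^sub>0 'k) set" and \<psi> \<omega> :: "'a \<Rightarrow> 'a"
  assumes comult_linear: "linear_into s (tensor_null s s) \<Delta>"
    and psi_linear: "Vector_Spaces.linear s s \<psi>"
    and omega_linear: "Vector_Spaces.linear s s \<omega>"
    and psi_omega: "\<psi> \<circ> \<omega> = \<omega> \<circ> \<psi>"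
    and psi_comult: "tensor_map s s \<psi> \<psi> \<circ> \<Delta> = \<Delta> \<circ> \<psi>"
    and omega_comult: "tensor_map s s \<omega> \<omega> \<circ> \<Delta> = \<Delta> \<circ> \<omega>"
    and bihom_coassoc:
      "tensor_map_left s s s \<Delta> \<psi> \<circ> \<Delta> = tensor_map_right s s s \<omega> \<Delta> \<circ> \<Delta>"

locale infBH_bialgebra =
  bihom_algebra s \<mu> \<alpha> \<beta> + bihom_coalgebra s \<Delta> \<psi> \<omega>
  for lam :: "'k::field" and s :: "'k \<Rightarrow> 'a \<Rightarrow> 'a::ab_group_add"
    and \<mu> :: "'a \<Rightarrow> 'a \<Rightarrow> 'a" and \<Delta> :: "'a \<Rightarrow> ('a \<times> 'a \<Rightarrow>\<^sub>0 'k) set"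
    and \<alpha> \<beta> \<psi> \<omega> :: "'a \<Rightarrow> 'a" +
  assumes alpha_psi: "\<alpha> \<circ> \<psi> = \<psi> \<circ> \<alpha>" and alpha_omega: "\<alpha> \<circ> \<omega> = \<omega> \<circ> \<alpha>"
    and beta_psi: "\<beta> \<circ> \<psi> = \<psi> \<circ> \<beta>" and beta_omega: "\<beta> \<circ> \<omega> = \<omega> \<circ> \<beta>"
    and alpha_comult: "tensor_map s s \<alpha> \<alpha> \<circ> \<Delta> = \<Delta> \<circ> \<alpha>"
    and beta_comult: "tensor_map s s \<beta> \<beta> \<circ> \<Delta> = \<Delta> \<circ> \<beta>"
    and psi_mult: "\<psi> (\<mu> a b) = \<mu> (\<psi> a) (\<psi> b)"
    and omega_mult: "\<omega> (\<mu> a b) = \<mu> (\<omega> a) (\<omega> b)"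
    and comult_mult:
      "\<Delta> (\<mu> a b) =
         tensor_map s s (\<mu> (\<omega> a)) \<beta> (\<Delta> b)
         + tensor_map s s \<alpha> (\<lambda>x. \<mu> x (\<psi> b)) (\<Delta> a)
         + coset_scale (tensor_null s s) lam (tensor s s (\<alpha> (\<omega> a)) (\<beta> (\<psi> b)))"

definition inf_bialgebra ::
    "'k::field \<Rightarrow> ('k \<Rightarrow> 'a \<Rightarrow> 'a::ab_group_add) \<Rightarrow> ('a \<Rightarrow> 'a \<Rightarrow> 'a) \<Rightarrow>
     ('a \<Rightarrow> ('a \<times> 'a \<Rightarrow>\<^sub>0 'k) set) \<Rightarrow> bool" where
  "inf_bialgebra lam s \<mu> \<Delta> \<longleftrightarrow> infBH_bialgebra lam s \<mu> \<Delta> id id id id"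

definition algebra_morphism ::
    "('k::field \<Rightarrow> 'a \<Rightarrow> 'a::ab_group_add) \<Rightarrow> ('a \<Rightarrow> 'a \<Rightarrow> 'a) \<Rightarrow> ('a \<Rightarrow> 'a) \<Rightarrow> bool" where
  "algebra_morphism s \<mu> f \<longleftrightarrow>
     Vector_Spaces.linear s s f \<and> (\<forall>a b. f (\<mu> a b) = \<mu> (f a) (f b))"

definition coalgebra_morphism ::
    "('k::field \<Rightarrow> 'a \<Rightarrow> 'a::ab_group_add) \<Rightarrow> ('a \<Rightarrow> ('a \<times> 'a \<Rightarrow>\<^sub>0 'k) set) \<Rightarrow> ('a \<Rightarrow> 'a) \<Rightarrow> bool" where
  "coalgebra_morphism s \<Delta> f \<longleftrightarrow>
     Vector_Spaces.linear s s f \<and> tensor_map s s f f \<circ> \<Delta> = \<Delta> \<circ> f"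


section \<open>Bimodules, bicomodules and Hopf bimodules\<close>

text \<open>
  Subscripts of the structure maps refer to the algebra \<open>A\<close> and the module \<open>M\<close>; \<open>lact a m\<close> is
  \<open>a \<triangleright> m\<close> and \<open>ract m a\<close> is \<open>m \<triangleleft> a\<close>.
\<close>

locale bihom_bimodule =
  A: bihom_algebra s\<^sub>A \<mu> \<alpha>\<^sub>A \<beta>\<^sub>A + M: vector_space s\<^sub>M
  for s\<^sub>A :: "'k::field \<Rightarrow> 'a \<Rightarrow> 'a::ab_group_add" and \<mu> :: "'a \<Rightarrow> 'a \<Rightarrow> 'a"
    and \<alpha>\<^sub>A \<beta>\<^sub>A :: "'a \<Rightarrow> 'a"
    and s\<^sub>M :: "'k \<Rightarrow> 'm \<Rightarrow> 'm::ab_group_add" +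
  fixes lact :: "'a \<Rightarrow> 'm \<Rightarrow> 'm" and ract :: "'m \<Rightarrow> 'a \<Rightarrow> 'm" and \<alpha>\<^sub>M \<beta>\<^sub>M :: "'m \<Rightarrow> 'm"
  assumes lact_bilinear: "bilinear_map s\<^sub>A s\<^sub>M s\<^sub>M lact"
    and ract_bilinear: "bilinear_map s\<^sub>M s\<^sub>A s\<^sub>M ract"
    and alphaM_linear: "Vector_Spaces.linear s\<^sub>M s\<^sub>M \<alpha>\<^sub>M"
    and betaM_linear: "Vector_Spaces.linear s\<^sub>M s\<^sub>M \<beta>\<^sub>M"
    and alphaM_betaM: "\<alpha>\<^sub>M \<circ> \<beta>\<^sub>M = \<beta>\<^sub>M \<circ> \<alpha>\<^sub>M"
    and alphaM_lact: "\<alpha>\<^sub>M (lact a m) = lact (\<alpha>\<^sub>A a) (\<alpha>\<^sub>M m)"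
    and betaM_lact: "\<beta>\<^sub>M (lact a m) = lact (\<beta>\<^sub>A a) (\<beta>\<^sub>M m)"
    and alphaM_ract: "\<alpha>\<^sub>M (ract m a) = ract (\<alpha>\<^sub>M m) (\<alpha>\<^sub>A a)"
    and betaM_ract: "\<beta>\<^sub>M (ract m a) = ract (\<beta>\<^sub>M m) (\<beta>\<^sub>A a)"
    and lact_lact: "lact (\<alpha>\<^sub>A a) (lact a' m) = lact (\<mu> a a') (\<beta>\<^sub>M m)"
    and ract_ract: "ract (\<alpha>\<^sub>M m) (\<mu> a a') = ract (ract m a) (\<beta>\<^sub>A a')"
    and lact_ract: "lact (\<alpha>\<^sub>A a) (ract m a') = ract (lact a m) (\<beta>\<^sub>A a')"

locale bihom_bicomodule =
  A: bihom_coalgebra s\<^sub>A \<Delta> \<psi>\<^sub>A \<omega>\<^sub>A + M: vector_space s\<^sub>M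
  for s\<^sub>A :: "'k::field \<Rightarrow> 'a \<Rightarrow> 'a::ab_group_add" and \<Delta> :: "'a \<Rightarrow> ('a \<times> 'a \<Rightarrow>\<^sub>0 'k) set"
    and \<psi>\<^sub>A \<omega>\<^sub>A :: "'a \<Rightarrow> 'a"
    and s\<^sub>M :: "'k \<Rightarrow> 'm \<Rightarrow> 'm::ab_group_add" +
  fixes \<rho> :: "'m \<Rightarrow> ('a \<times> 'm \<Rightarrow>\<^sub>0 'k) set" and \<phi> :: "'m \<Rightarrow> ('m \<times> 'a \<Rightarrow>\<^sub>0 'k) set"
    and \<psi>\<^sub>M \<omega>\<^sub>M :: "'m \<Rightarrow> 'm"
  assumes rho_linear: "linear_into s\<^sub>M (tensor_null s\<^sub>A s\<^sub>M) \<rho>"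
    and phi_linear: "linear_into s\<^sub>M (tensor_null s\<^sub>M s\<^sub>A) \<phi>"
    and psiM_linear: "Vector_Spaces.linear s\<^sub>M s\<^sub>M \<psi>\<^sub>M"
    and omegaM_linear: "Vector_Spaces.linear s\<^sub>M s\<^sub>M \<omega>\<^sub>M"
    and psiM_omegaM: "\<psi>\<^sub>M \<circ> \<omega>\<^sub>M = \<omega>\<^sub>M \<circ> \<psi>\<^sub>M"
    and psiM_rho: "tensor_map s\<^sub>A s\<^sub>M \<psi>\<^sub>A \<psi>\<^sub>M \<circ> \<rho> = \<rho> \<circ> \<psi>\<^sub>M"
    and omegaM_rho: "tensor_map s\<^sub>A s\<^sub>M \<omega>\<^sub>A \<omega>\<^sub>M \<circ> \<rho> = \<rho> \<circ> \<omega>\<^sub>M"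
    and psiM_phi: "tensor_map s\<^sub>M s\<^sub>A \<psi>\<^sub>M \<psi>\<^sub>A \<circ> \<phi> = \<phi> \<circ> \<psi>\<^sub>M"
    and omegaM_phi: "tensor_map s\<^sub>M s\<^sub>A \<omega>\<^sub>M \<omega>\<^sub>A \<circ> \<phi> = \<phi> \<circ> \<omega>\<^sub>M"
    and rho_coassoc:
      "tensor_map_right s\<^sub>A s\<^sub>A s\<^sub>M \<omega>\<^sub>A \<rho> \<circ> \<rho> = tensor_map_left s\<^sub>A s\<^sub>A s\<^sub>M \<Delta> \<psi>\<^sub>M \<circ> \<rho>"
    and phi_coassoc:
      "tensor_map_right s\<^sub>M s\<^sub>A s\<^sub>A \<omega>\<^sub>M \<Delta> \<circ> \<phi> = tensor_map_left s\<^sub>M s\<^sub>A s\<^sub>A \<phi> \<psi>\<^sub>A \<circ> \<phi>"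
    and rho_phi_coassoc:
      "tensor_map_right s\<^sub>A s\<^sub>M s\<^sub>A \<omega>\<^sub>A \<phi> \<circ> \<rho> = tensor_map_left s\<^sub>A s\<^sub>M s\<^sub>A \<rho> \<psi>\<^sub>A \<circ> \<phi>"

locale infBH_Hopf_bimodule =
  infBH_bialgebra lam s\<^sub>A \<mu> \<Delta> \<alpha>\<^sub>A \<beta>\<^sub>A \<psi>\<^sub>A \<omega>\<^sub>A +
  bihom_bimodule s\<^sub>A \<mu> \<alpha>\<^sub>A \<beta>\<^sub>A s\<^sub>M lact ract \<alpha>\<^sub>M \<beta>\<^sub>M +
  bihom_bicomodule s\<^sub>A \<Delta> \<psi>\<^sub>A \<omega>\<^sub>A s\<^sub>M \<rho> \<phi> \<psi>\<^sub>M \<omega>\<^sub>M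
  for lam :: "'k::field"
    and s\<^sub>A :: "'k \<Rightarrow> 'a \<Rightarrow> 'a::ab_group_add" and \<mu> :: "'a \<Rightarrow> 'a \<Rightarrow> 'a"
    and \<Delta> :: "'a \<Rightarrow> ('a \<times> 'a \<Rightarrow>\<^sub>0 'k) set" and \<alpha>\<^sub>A \<beta>\<^sub>A \<psi>\<^sub>A \<omega>\<^sub>A :: "'a \<Rightarrow> 'a"
    and s\<^sub>M :: "'k \<Rightarrow> 'm \<Rightarrow> 'm::ab_group_add"
    and lact :: "'a \<Rightarrow> 'm \<Rightarrow> 'm" and ract :: "'m \<Rightarrow> 'a \<Rightarrow> 'm"
    and \<rho> :: "'m \<Rightarrow> ('a \<times> 'm \<Rightarrow>\<^sub>0 'k) set" and \<phi> :: "'m \<Rightarrow> ('m \<times> 'a \<Rightarrow>\<^sub>0 'k) set"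
    and \<alpha>\<^sub>M \<beta>\<^sub>M \<psi>\<^sub>M \<omega>\<^sub>M :: "'m \<Rightarrow> 'm" +
  assumes structure_maps_commute: "pairwise_commute {\<alpha>\<^sub>M, \<beta>\<^sub>M, \<psi>\<^sub>M, \<omega>\<^sub>M}"
    and rho_lact:
      "\<rho> (lact a m) =
         tensor_map s\<^sub>A s\<^sub>M (\<mu> (\<omega>\<^sub>A a)) \<beta>\<^sub>M (\<rho> m)
         + tensor_map s\<^sub>A s\<^sub>M \<alpha>\<^sub>A (\<lambda>x. lact x (\<psi>\<^sub>M m)) (\<Delta> a)
         + coset_scale (tensor_null s\<^sub>A s\<^sub>M) lam (tensor s\<^sub>A s\<^sub>M (\<alpha>\<^sub>A (\<omega>\<^sub>A a)) (\<beta>\<^sub>M (\<psi>\<^sub>M m)))"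
    and phi_ract:
      "\<phi> (ract m a) =
         tensor_map s\<^sub>M s\<^sub>A (ract (\<omega>\<^sub>M m)) \<beta>\<^sub>A (\<Delta> a)
         + tensor_map s\<^sub>M s\<^sub>A \<alpha>\<^sub>M (\<lambda>x. \<mu> x (\<psi>\<^sub>A a)) (\<phi> m)
         + coset_scale (tensor_null s\<^sub>M s\<^sub>A) lam (tensor s\<^sub>M s\<^sub>A (\<alpha>\<^sub>M (\<omega>\<^sub>M m)) (\<beta>\<^sub>A (\<psi>\<^sub>A a)))"
    and phi_lact: "\<phi> (lact a m) = tensor_map s\<^sub>M s\<^sub>A (lact (\<omega>\<^sub>A a)) \<beta>\<^sub>A (\<phi> m)"
    and rho_ract: "\<rho> (ract m a) = tensor_map s\<^sub>A s\<^sub>M \<alpha>\<^sub>A (\<lambda>x. ract x (\<psi>\<^sub>A a)) (\<rho> m)"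

definition inf_Hopf_bimodule ::
    "'k::field \<Rightarrow> ('k \<Rightarrow> 'a \<Rightarrow> 'a::ab_group_add) \<Rightarrow> ('a \<Rightarrow> 'a \<Rightarrow> 'a) \<Rightarrow>
     ('a \<Rightarrow> ('a \<times> 'a \<Rightarrow>\<^sub>0 'k) set) \<Rightarrow> ('k \<Rightarrow> 'm \<Rightarrow> 'm::ab_group_add) \<Rightarrow>
     ('a \<Rightarrow> 'm \<Rightarrow> 'm) \<Rightarrow> ('m \<Rightarrow> 'a \<Rightarrow> 'm) \<Rightarrow>
     ('m \<Rightarrow> ('a \<times> 'm \<Rightarrow>\<^sub>0 'k) set) \<Rightarrow> ('m \<Rightarrow> ('m \<times> 'a \<Rightarrow>\<^sub>0 'k) set) \<Rightarrow> bool" where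
  "inf_Hopf_bimodule lam s\<^sub>A \<mu> \<Delta> s\<^sub>M lact ract \<rho> \<phi> \<longleftrightarrow>
     infBH_Hopf_bimodule lam s\<^sub>A \<mu> \<Delta> id id id id s\<^sub>M lact ract \<rho> \<phi> id id id id"

end

theory Submission
  imports Defs
begin

text \<open>
  All structure maps are (co)multiplicative and commute with each other, so in each twisted axiom they
  can be moved past the (co)multiplications, (co)actions and each other; both sides then become the
  same tensor product of structure maps applied to the corresponding untwisted axiom. The identities
  between maps on a tensor product are checked on pure tensors.
\<close>

section \<open>Linear maps between tensor products\<close>

definition coset_linear ::
    "('x \<Rightarrow>\<^sub>0 'k::field) set \<Rightarrow> ('y \<Rightarrow>\<^sub>0 'k) set \<Rightarrow> (('x \<Rightarrow>\<^sub>0 'k) set \<Rightarrow> ('y \<Rightarrow>\<^sub>0 'k) set) \<Rightarrow> bool" where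
  "coset_linear N N' F \<longleftrightarrow>
     (\<forall>X\<in>quotient_space N. F X \<in> quotient_space N') \<and>
     (\<forall>X\<in>quotient_space N. \<forall>Y\<in>quotient_space N. F (X + Y) = F X + F Y) \<and>
     (\<forall>c. \<forall>X\<in>quotient_space N. F (coset_scale N c X) = coset_scale N' c (F X))"

lemma coset_linear_comp:
  assumes "coset_linear N N' F" "coset_linear N' N'' G"
  shows "coset_linear N N'' (\<lambda>X. G (F X))"
  using assms by (simp add: coset_linear_def)

lemma linear_into_coset_linear:
  assumes "linear_into s N D" "coset_linear N N' F"
  shows "linear_into s N' (\<lambda>x. F (D x))"
  using assms by (simp add: linear_into_def coset_linear_def)

lemma linear_into_linear:
  assumes "Vector_Spaces.linear s t f" "linear_into t N D"
  shows "linear_into s N (\<lambda>x. D (f x))"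
  using assms by (simp add: linear_into_def Vector_Spaces.linear_iff)

lemma linear_into_tensor:
  shows "linear_into s1 (tensor_null s1 s2) (\<lambda>a. tensor s1 s2 a b)"
    and "linear_into s2 (tensor_null s1 s2) (\<lambda>b. tensor s1 s2 a b)"
  by (simp_all add: linear_into_def tensor_bilinear) (auto simp: quotient_space_def tensor_def)

lemma linear_into_tensor3:
  shows "linear_into s1 (tensor3_null s1 s2 s3) (\<lambda>a. tensor3 s1 s2 s3 a b d)"
    and "linear_into s2 (tensor3_null s1 s2 s3) (\<lambda>b. tensor3 s1 s2 s3 a b d)"
    and "linear_into s3 (tensor3_null s1 s2 s3) (\<lambda>d. tensor3 s1 s2 s3 a b d)"
  by (simp_all add: linear_into_def tensor3_trilinear) (auto simp: quotient_space_def tensor3_def)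

lemma subspace_mem_quotient:
  fixes N :: "('x \<Rightarrow>\<^sub>0 'k::field) set"
  shows "N \<in> quotient_space N"
proof -
  have "N = 0 +o N" by (simp add: elt_set_plus_def)
  then show ?thesis unfolding quotient_space_def by blast
qed

lemma coset_linear_subspace:
  assumes "free.subspace N" "free.subspace N'" "coset_linear N N' F"
  shows "F N = N'"
proof -
  have z: "coset_scale L 0 L = L" if "free.subspace L" for L :: "('z \<Rightarrow>\<^sub>0 'k::field) set"
    using coset_scale_coset[OF that, of 0 0] by (simp add: elt_set_plus_def)
  have z': "coset_scale L 0 (x +o L) = L" if "free.subspace L" for L :: "('z \<Rightarrow>\<^sub>0 'k::field) set" and x
    using coset_scale_coset[OF that, of 0 x] by (simp add: elt_set_plus_def)
  have "F N \<in> quotient_space N'"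
    using assms(3) subspace_mem_quotient[of N] by (simp add: coset_linear_def)
  then obtain y where "F N = y +o N'" by (auto simp: quotient_space_def)
  moreover have "F (coset_scale N 0 N) = coset_scale N' 0 (F N)"
    using assms(3) subspace_mem_quotient[of N] by (simp add: coset_linear_def)
  ultimately show ?thesis by (simp add: z z' assms)
qed

lemma coset_linear_tensor_eq:
  assumes N: "free.subspace N"
    and F: "coset_linear (tensor_null s1 s2) N F" and G: "coset_linear (tensor_null s1 s2) N G"
    and eq: "\<And>a b. F (tensor s1 s2 a b) = G (tensor s1 s2 a b)"
    and X: "X \<in> quotient_space (tensor_null s1 s2)"
  shows "F X = G X"
  using X
proof (induction rule: tensor_space_induct)
  case zero
  then show ?case
    by (simp add: coset_linear_subspace[OF subspace_tensor_null N F]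
        coset_linear_subspace[OF subspace_tensor_null N G])
next
  case (tensor c a b Y)
  have t: "tensor s1 s2 a b \<in> quotient_space (tensor_null s1 s2)"
    by (auto simp: quotient_space_def tensor_def)
  then have "coset_scale (tensor_null s1 s2) c (tensor s1 s2 a b) \<in> quotient_space (tensor_null s1 s2)"
    by (auto simp: quotient_space_def coset_scale_coset[OF subspace_tensor_null])
  then show ?case using F G eq tensor t by (simp add: coset_linear_def)
qed

lemma coset_linear_lift:
  fixes N :: "('y \<Rightarrow>\<^sub>0 'k::field) set"
  assumes N: "free.subspace N" and h: "\<And>k. h k = r k +o N"
    and R: "\<And>x. x \<in> R \<Longrightarrow> linear_extension free_scale r x \<in> N"
  shows "coset_linear (free.span R) N (coset_lift N h)"
    and "coset_lift N h (basis_vec k +o free.span R) = h k"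
proof -
  let ?L = "linear_extension free_scale r"
  interpret L: Vector_Spaces.linear free_scale free_scale ?L
    by (rule linear_linear_extension[OF vector_space_free_scale])
  have S: "free.subspace (free.span R)" by simp
  have lift: "coset_lift N h (x +o free.span R) = ?L x +o N" for x
    using coset_lift_coset[OF N R, where x = x] by (simp add: ext[OF h])
  show "coset_linear (free.span R) N (coset_lift N h)"
    by (auto simp: coset_linear_def quotient_space_def coset_plus[OF N] coset_plus[OF S]
        coset_scale_coset[OF N] coset_scale_coset[OF S] lift L.add L.scale)
  show "coset_lift N h (basis_vec k +o free.span R) = h k"
    by (simp add: lift h linear_extension_basis[OF vector_space_free_scale])
qed

lemma linear_into_rep:
  assumes N: "free.subspace N" and D: "linear_into s N D" and r: "\<And>x. D x = r x +o N"
  shows "r (x + y) - r x - r y \<in> N" and "r (s c x) - free_scale c (r x) \<in> N"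
proof -
  have "r (x + y) +o N = (r x + r y) +o N" "r (s c x) +o N = free_scale c (r x) +o N"
    using D by (simp_all add: linear_into_def r coset_plus[OF N] coset_scale_coset[OF N])
  then show "r (x + y) - r x - r y \<in> N" "r (s c x) - free_scale c (r x) \<in> N"
    by (simp_all add: coset_eq_iff[OF N] diff_diff_eq)
qed

lemma coset_lift_tensor:
  assumes N: "free.subspace N"
    and h1: "\<And>b. linear_into s1 N (\<lambda>a. h (a, b))" and h2: "\<And>a. linear_into s2 N (\<lambda>b. h (a, b))"
  shows "coset_linear (tensor_null s1 s2) N (coset_lift N h)"
    and "coset_lift N h (tensor s1 s2 a b) = h (a, b)"
proof -
  have "h (a, b) \<in> quotient_space N" for a b using h1 by (simp add: linear_into_def)
  then have "\<exists>x. h k = x +o N" for k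
    by (cases k) (force simp: quotient_space_def)
  then obtain r where r: "\<And>k. h k = r k +o N" by metis
  let ?L = "linear_extension free_scale r"
  interpret L: Vector_Spaces.linear free_scale free_scale ?L
    by (rule linear_linear_extension[OF vector_space_free_scale])
  note rep = linear_into_rep[OF N h1 r] linear_into_rep[OF N h2 r]
  show "coset_linear (tensor_null s1 s2) N (coset_lift N h)"
    and "coset_lift N h (tensor s1 s2 a b) = h (a, b)"
    unfolding tensor_def tensor_null_def
    by (rule coset_linear_lift[OF N r];
        auto simp: L.diff L.scale linear_extension_basis[OF vector_space_free_scale] rep)+
qed

lemma coset_lift_tensor3:
  assumes N: "free.subspace N"
    and h1: "\<And>b d. linear_into s1 N (\<lambda>a. h (a, b, d))"
    and h2: "\<And>a d. linear_into s2 N (\<lambda>b. h (a, b, d))"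
    and h3: "\<And>a b. linear_into s3 N (\<lambda>d. h (a, b, d))"
  shows "coset_linear (tensor3_null s1 s2 s3) N (coset_lift N h)"
    and "coset_lift N h (tensor3 s1 s2 s3 a b d) = h (a, b, d)"
proof -
  have "h (a, b, d) \<in> quotient_space N" for a b d using h1 by (simp add: linear_into_def)
  then have "\<exists>x. h k = x +o N" for k
    by (cases k) (force simp: quotient_space_def)
  then obtain r where r: "\<And>k. h k = r k +o N" by metis
  let ?L = "linear_extension free_scale r"
  interpret L: Vector_Spaces.linear free_scale free_scale ?L
    by (rule linear_linear_extension[OF vector_space_free_scale])
  note rep = linear_into_rep[OF N h1 r] linear_into_rep[OF N h2 r] linear_into_rep[OF N h3 r]
  show "coset_linear (tensor3_null s1 s2 s3) N (coset_lift N h)"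
    and "coset_lift N h (tensor3 s1 s2 s3 a b d) = h (a, b, d)"
    unfolding tensor3_def tensor3_null_def
    by (rule coset_linear_lift[OF N r];
        auto simp: L.diff L.scale linear_extension_basis[OF vector_space_free_scale] rep)+
qed

lemma coset_linear_tensor_map:
  assumes "Vector_Spaces.linear s1 t1 f" "Vector_Spaces.linear s2 t2 g"
  shows "coset_linear (tensor_null s1 s2) (tensor_null t1 t2) (tensor_map t1 t2 f g)"
  unfolding tensor_map_def
  by (rule coset_lift_tensor(1)[OF subspace_tensor_null])
    (simp_all add: linear_into_linear[OF assms(1) linear_into_tensor(1)]
      linear_into_linear[OF assms(2) linear_into_tensor(2)])

lemma linear_comp:
  assumes "Vector_Spaces.linear s1 s2 f" "Vector_Spaces.linear s2 s3 g"
  shows "Vector_Spaces.linear s1 s3 (\<lambda>x. g (f x))"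
  using assms by (simp add: Vector_Spaces.linear_iff)

lemma tensor_map_tensor_map:
  assumes X: "X \<in> quotient_space (tensor_null s1 s2)"
    and f: "Vector_Spaces.linear s1 t1 f" and g: "Vector_Spaces.linear s2 t2 g"
    and f': "Vector_Spaces.linear t1 u1 f'" and g': "Vector_Spaces.linear t2 u2 g'"
  shows "tensor_map u1 u2 f' g' (tensor_map t1 t2 f g X) =
         tensor_map u1 u2 (\<lambda>x. f' (f x)) (\<lambda>x. g' (g x)) X"
  by (rule coset_linear_tensor_eq[OF subspace_tensor_null
        coset_linear_comp[OF coset_linear_tensor_map[OF f g] coset_linear_tensor_map[OF f' g']]
        coset_linear_tensor_map[OF linear_comp[OF f f'] linear_comp[OF g g']] _ X])
    (simp add: tensor_map_tensor[OF f g] tensor_map_tensor[OF f' g']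
      tensor_map_tensor[OF linear_comp[OF f f'] linear_comp[OF g g']])

definition tensor3_map ::
    "('k::field \<Rightarrow> 'a' \<Rightarrow> 'a'::ab_group_add) \<Rightarrow> ('k \<Rightarrow> 'b' \<Rightarrow> 'b'::ab_group_add) \<Rightarrow>
     ('k \<Rightarrow> 'c' \<Rightarrow> 'c'::ab_group_add) \<Rightarrow> ('a \<Rightarrow> 'a') \<Rightarrow> ('b \<Rightarrow> 'b') \<Rightarrow> ('c \<Rightarrow> 'c') \<Rightarrow>
     ('a \<times> 'b \<times> 'c \<Rightarrow>\<^sub>0 'k) set \<Rightarrow> ('a' \<times> 'b' \<times> 'c' \<Rightarrow>\<^sub>0 'k) set" where
  "tensor3_map t1 t2 t3 f g h = coset_lift (tensor3_null t1 t2 t3)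
     (\<lambda>(a, b, c). tensor3 t1 t2 t3 (f a) (g b) (h c))"

lemma tensor3_map:
  assumes "Vector_Spaces.linear s1 t1 f" "Vector_Spaces.linear s2 t2 g" "Vector_Spaces.linear s3 t3 h"
  shows "coset_linear (tensor3_null s1 s2 s3) (tensor3_null t1 t2 t3) (tensor3_map t1 t2 t3 f g h)"
    and "tensor3_map t1 t2 t3 f g h (tensor3 s1 s2 s3 a b c) = tensor3 t1 t2 t3 (f a) (g b) (h c)"
proof -
  note lin = linear_into_linear[OF assms(1) linear_into_tensor3(1)]
    linear_into_linear[OF assms(2) linear_into_tensor3(2)]
    linear_into_linear[OF assms(3) linear_into_tensor3(3)]
  show "coset_linear (tensor3_null s1 s2 s3) (tensor3_null t1 t2 t3) (tensor3_map t1 t2 t3 f g h)"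
    unfolding tensor3_map_def
    by (rule coset_lift_tensor3(1)[OF subspace_tensor3_null]) (simp_all add: lin)
  have "tensor3_map t1 t2 t3 f g h (tensor3 s1 s2 s3 a b c) =
      (\<lambda>(a, b, c). tensor3 t1 t2 t3 (f a) (g b) (h c)) (a, b, c)"
    unfolding tensor3_map_def
    by (rule coset_lift_tensor3(2)[OF subspace_tensor3_null]) (simp_all add: lin)
  then show "tensor3_map t1 t2 t3 f g h (tensor3 s1 s2 s3 a b c) = tensor3 t1 t2 t3 (f a) (g b) (h c)"
    by simp
qed

lemma coset_linear_add:
  assumes "free.subspace N'" "coset_linear N N' F" "coset_linear N N' G"
  shows "coset_linear N N' (\<lambda>X. F X + G X)"
proof -
  have "X + Y \<in> quotient_space N'" "coset_scale N' c (X + Y) = coset_scale N' c X + coset_scale N' c Y"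
    if "X \<in> quotient_space N'" "Y \<in> quotient_space N'" for X Y c
    using that by (auto simp: quotient_space_def coset_plus[OF assms(1)]
        coset_scale_coset[OF assms(1)] free.scale_right_distrib)
  then show ?thesis
    using assms(2,3) by (simp add: coset_linear_def ac_simps)
qed

lemma coset_linear_scale:
  assumes "free.subspace N'" "coset_linear N N' F"
  shows "coset_linear N N' (\<lambda>X. coset_scale N' c (F X))"
proof -
  have "coset_scale N' c X \<in> quotient_space N'"
    "coset_scale N' c (coset_scale N' d X) = coset_scale N' d (coset_scale N' c X)"
    if "X \<in> quotient_space N'" for X d
    using that by (auto simp: quotient_space_def coset_plus[OF assms(1)]
        coset_scale_coset[OF assms(1)] mult.commute)
  moreover have "coset_scale N' c (X + Y) = coset_scale N' c X + coset_scale N' c Y"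
    if "X \<in> quotient_space N'" "Y \<in> quotient_space N'" for X Y
    using that by (auto simp: quotient_space_def coset_plus[OF assms(1)]
        coset_scale_coset[OF assms(1)] free.scale_right_distrib)
  ultimately show ?thesis
    using assms(2) by (simp add: coset_linear_def)
qed

lemma linear_into_coset_lift:
  assumes N: "free.subspace N" and Y: "Y \<in> quotient_space (tensor_null s1 s2)"
    and h1: "\<And>d b. linear_into s1 N (\<lambda>a. h d (a, b))"
    and h2: "\<And>d a. linear_into s2 N (\<lambda>b. h d (a, b))"
    and h: "\<And>a b. linear_into t N (\<lambda>d. h d (a, b))"
  shows "linear_into t N (\<lambda>d. coset_lift N (h d) Y)"
proof -
  note lift = coset_lift_tensor[where h = "h _", OF N h1 h2]
  have "coset_lift N (h (d + d')) Y = coset_lift N (h d) Y + coset_lift N (h d') Y" for d d'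
    by (rule coset_linear_tensor_eq[OF N lift(1) coset_linear_add[OF N lift(1) lift(1)] _ Y])
      (use h in \<open>simp add: lift(2) linear_into_def\<close>)
  moreover have "coset_lift N (h (t c d)) Y = coset_scale N c (coset_lift N (h d) Y)" for c d
    by (rule coset_linear_tensor_eq[OF N lift(1) coset_linear_scale[OF N lift(1)] _ Y])
      (use h in \<open>simp add: lift(2) linear_into_def\<close>)
  ultimately show ?thesis
    using lift(1) Y by (simp add: linear_into_def coset_linear_def)
qed

lemma coset_lift_tensor3_fixed:
  fixes s1 :: "'k::field \<Rightarrow> 'a \<Rightarrow> 'a::ab_group_add" and s2 :: "'k \<Rightarrow> 'b \<Rightarrow> 'b::ab_group_add"
    and s3 :: "'k \<Rightarrow> 'c \<Rightarrow> 'c::ab_group_add"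
  defines "N \<equiv> tensor3_null s1 s2 s3"
  shows "coset_linear (tensor_null s1 s2) N (coset_lift N (\<lambda>(x, y). tensor3 s1 s2 s3 x y z))"
    and "coset_lift N (\<lambda>(x, y). tensor3 s1 s2 s3 x y z) (tensor s1 s2 x y) = tensor3 s1 s2 s3 x y z"
    and "coset_linear (tensor_null s2 s3) N (coset_lift N (\<lambda>(y, z). tensor3 s1 s2 s3 x y z))"
    and "coset_lift N (\<lambda>(y, z). tensor3 s1 s2 s3 x y z) (tensor s2 s3 y z) = tensor3 s1 s2 s3 x y z"
  unfolding N_def
  by (simp_all add: coset_lift_tensor[OF subspace_tensor3_null] linear_into_tensor3)

lemma tensor_map_left:
  assumes D: "linear_into u1 (tensor_null s1 s2) D" and g: "Vector_Spaces.linear u2 s3 g"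
  shows "coset_linear (tensor_null u1 u2) (tensor3_null s1 s2 s3) (tensor_map_left s1 s2 s3 D g)"
    and "tensor_map_left s1 s2 s3 D g (tensor u1 u2 a b) =
         coset_lift (tensor3_null s1 s2 s3) (\<lambda>(x, y). tensor3 s1 s2 s3 x y (g b)) (D a)"
proof -
  let ?N = "tensor3_null s1 s2 s3" and ?h = "\<lambda>d (x, y). tensor3 s1 s2 s3 x y d"
  have D_mem: "D x \<in> quotient_space (tensor_null s1 s2)" for x
    using D by (simp add: linear_into_def)
  have "linear_into u1 ?N (\<lambda>a. coset_lift ?N (?h d) (D a))" for d
    by (rule linear_into_coset_linear[OF D], rule coset_lift_tensor(1)[OF subspace_tensor3_null])
      (simp_all add: linear_into_tensor3)
  moreover have "linear_into u2 ?N (\<lambda>b. coset_lift ?N (?h (g b)) (D a))" for a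
    by (rule linear_into_linear[OF g], rule linear_into_coset_lift[OF subspace_tensor3_null D_mem])
      (simp_all add: linear_into_tensor3)
  ultimately show "coset_linear (tensor_null u1 u2) ?N (tensor_map_left s1 s2 s3 D g)"
    and "tensor_map_left s1 s2 s3 D g (tensor u1 u2 a b) = coset_lift ?N (?h (g b)) (D a)"
    unfolding tensor_map_left_def
    by (simp_all add: coset_lift_tensor[OF subspace_tensor3_null])
qed

lemma tensor_map_right:
  assumes D: "linear_into u2 (tensor_null s2 s3) D" and f: "Vector_Spaces.linear u1 s1 f"
  shows "coset_linear (tensor_null u1 u2) (tensor3_null s1 s2 s3) (tensor_map_right s1 s2 s3 f D)"
    and "tensor_map_right s1 s2 s3 f D (tensor u1 u2 a b) =
         coset_lift (tensor3_null s1 s2 s3) (\<lambda>(x, y). tensor3 s1 s2 s3 (f a) x y) (D b)"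
proof -
  let ?N = "tensor3_null s1 s2 s3" and ?h = "\<lambda>d (x, y). tensor3 s1 s2 s3 d x y"
  have D_mem: "D x \<in> quotient_space (tensor_null s2 s3)" for x
    using D by (simp add: linear_into_def)
  have "linear_into u2 ?N (\<lambda>b. coset_lift ?N (?h d) (D b))" for d
    by (rule linear_into_coset_linear[OF D], rule coset_lift_tensor(1)[OF subspace_tensor3_null])
      (simp_all add: linear_into_tensor3)
  moreover have "linear_into u1 ?N (\<lambda>a. coset_lift ?N (?h (f a)) (D b))" for b
    by (rule linear_into_linear[OF f], rule linear_into_coset_lift[OF subspace_tensor3_null D_mem])
      (simp_all add: linear_into_tensor3)
  ultimately show "coset_linear (tensor_null u1 u2) ?N (tensor_map_right s1 s2 s3 f D)"
    and "tensor_map_right s1 s2 s3 f D (tensor u1 u2 a b) = coset_lift ?N (?h (f a)) (D b)"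
    unfolding tensor_map_right_def
    by (simp_all add: coset_lift_tensor[OF subspace_tensor3_null])
qed

lemma tensor_map_left_tensor_map:
  assumes X: "X \<in> quotient_space (tensor_null u1 u2)"
    and D: "linear_into u1 (tensor_null s1 s2) D" and D': "linear_into v1 (tensor_null t1 t2) D'"
    and p: "Vector_Spaces.linear s1 t1 p" and q: "Vector_Spaces.linear s2 t2 q"
    and f: "Vector_Spaces.linear u1 v1 f" and g: "Vector_Spaces.linear u2 v2 g"
    and g': "Vector_Spaces.linear v2 t3 g'"
    and D'_f: "\<And>a. D' (f a) = tensor_map t1 t2 p q (D a)"
  shows "tensor_map_left t1 t2 t3 D' g' (tensor_map v1 v2 f g X) =
         tensor3_map t1 t2 t3 p q (\<lambda>x. g' (g x)) (tensor_map_left s1 s2 u2 D id X)"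
proof (rule coset_linear_tensor_eq[OF subspace_tensor3_null _ _ _ X])
  have "vector_space u2" using g by (simp add: Vector_Spaces.linear_iff)
  then have id: "Vector_Spaces.linear u2 u2 id" by (simp add: Vector_Spaces.linear_iff)
  note g'g = linear_comp[OF g g']
  note t3 = tensor3_map[OF p q g'g]
  show "coset_linear (tensor_null u1 u2) (tensor3_null t1 t2 t3)
      (\<lambda>X. tensor_map_left t1 t2 t3 D' g' (tensor_map v1 v2 f g X))"
    by (rule coset_linear_comp[OF coset_linear_tensor_map[OF f g] tensor_map_left(1)[OF D' g']])
  show "coset_linear (tensor_null u1 u2) (tensor3_null t1 t2 t3)
      (\<lambda>X. tensor3_map t1 t2 t3 p q (\<lambda>x. g' (g x)) (tensor_map_left s1 s2 u2 D id X))"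
    by (rule coset_linear_comp[OF tensor_map_left(1)[OF D id] t3(1)])
  fix a b
  have Da: "D a \<in> quotient_space (tensor_null s1 s2)" using D by (simp add: linear_into_def)
  note lift = coset_lift_tensor3_fixed(1,2)
  have "coset_lift (tensor3_null t1 t2 t3) (\<lambda>(x, y). tensor3 t1 t2 t3 x y (g' (g b)))
          (tensor_map t1 t2 p q (D a)) =
        tensor3_map t1 t2 t3 p q (\<lambda>x. g' (g x))
          (coset_lift (tensor3_null s1 s2 u2) (\<lambda>(x, y). tensor3 s1 s2 u2 x y b) (D a))"
    by (rule coset_linear_tensor_eq[OF subspace_tensor3_null
          coset_linear_comp[OF coset_linear_tensor_map[OF p q] lift(1)]
          coset_linear_comp[OF lift(1) t3(1)] _ Da])
      (simp add: lift t3(2) tensor_map_tensor[OF p q])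
  then show "tensor_map_left t1 t2 t3 D' g' (tensor_map v1 v2 f g (tensor u1 u2 a b)) =
      tensor3_map t1 t2 t3 p q (\<lambda>x. g' (g x)) (tensor_map_left s1 s2 u2 D id (tensor u1 u2 a b))"
    by (simp add: tensor_map_left[OF D' g'] tensor_map_left[OF D id] tensor_map_tensor[OF f g] D'_f)
qed

lemma tensor_map_right_tensor_map:
  assumes X: "X \<in> quotient_space (tensor_null u1 u2)"
    and D: "linear_into u2 (tensor_null s2 s3) D" and D': "linear_into v2 (tensor_null t2 t3) D'"
    and p: "Vector_Spaces.linear s2 t2 p" and q: "Vector_Spaces.linear s3 t3 q"
    and f: "Vector_Spaces.linear u1 v1 f" and g: "Vector_Spaces.linear u2 v2 g"
    and f': "Vector_Spaces.linear v1 t1 f'"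
    and D'_g: "\<And>b. D' (g b) = tensor_map t2 t3 p q (D b)"
  shows "tensor_map_right t1 t2 t3 f' D' (tensor_map v1 v2 f g X) =
         tensor3_map t1 t2 t3 (\<lambda>x. f' (f x)) p q (tensor_map_right u1 s2 s3 id D X)"
proof (rule coset_linear_tensor_eq[OF subspace_tensor3_null _ _ _ X])
  have "vector_space u1" using f by (simp add: Vector_Spaces.linear_iff)
  then have id: "Vector_Spaces.linear u1 u1 id" by (simp add: Vector_Spaces.linear_iff)
  note f'f = linear_comp[OF f f']
  note t3 = tensor3_map[OF f'f p q]
  show "coset_linear (tensor_null u1 u2) (tensor3_null t1 t2 t3)
      (\<lambda>X. tensor_map_right t1 t2 t3 f' D' (tensor_map v1 v2 f g X))"
    by (rule coset_linear_comp[OF coset_linear_tensor_map[OF f g] tensor_map_right(1)[OF D' f']])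
  show "coset_linear (tensor_null u1 u2) (tensor3_null t1 t2 t3)
      (\<lambda>X. tensor3_map t1 t2 t3 (\<lambda>x. f' (f x)) p q (tensor_map_right u1 s2 s3 id D X))"
    by (rule coset_linear_comp[OF tensor_map_right(1)[OF D id] t3(1)])
  fix a b
  have Db: "D b \<in> quotient_space (tensor_null s2 s3)" using D by (simp add: linear_into_def)
  note lift = coset_lift_tensor3_fixed(3,4)
  have "coset_lift (tensor3_null t1 t2 t3) (\<lambda>(x, y). tensor3 t1 t2 t3 (f' (f a)) x y)
          (tensor_map t2 t3 p q (D b)) =
        tensor3_map t1 t2 t3 (\<lambda>x. f' (f x)) p q
          (coset_lift (tensor3_null u1 s2 s3) (\<lambda>(x, y). tensor3 u1 s2 s3 a x y) (D b))"
    by (rule coset_linear_tensor_eq[OF subspace_tensor3_null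
          coset_linear_comp[OF coset_linear_tensor_map[OF p q] lift(1)]
          coset_linear_comp[OF lift(1) t3(1)] _ Db])
      (simp add: lift t3(2) tensor_map_tensor[OF p q])
  then show "tensor_map_right t1 t2 t3 f' D' (tensor_map v1 v2 f g (tensor u1 u2 a b)) =
      tensor3_map t1 t2 t3 (\<lambda>x. f' (f x)) p q (tensor_map_right u1 s2 s3 id D (tensor u1 u2 a b))"
    by (simp add: tensor_map_right[OF D' f'] tensor_map_right[OF D id] tensor_map_tensor[OF f g] D'_g)
qed

section \<open>Twisting\<close>

lemma linear_into_tensor_map_comp:
  assumes "linear_into s (tensor_null s1 s2) D"
    and "Vector_Spaces.linear s1 t1 f" "Vector_Spaces.linear s2 t2 g"
  shows "linear_into s (tensor_null t1 t2) (tensor_map t1 t2 f g \<circ> D)"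
  using linear_into_coset_linear[OF assms(1) coset_linear_tensor_map[OF assms(2,3)]]
  by (simp add: o_def)

lemma tensor_map_comp_commute:
  assumes D: "linear_into m (tensor_null s t) D"
    and "Vector_Spaces.linear s s g" "Vector_Spaces.linear t t h"
    and "Vector_Spaces.linear s s \<omega>" "Vector_Spaces.linear t t \<psi>"
    and "\<omega> \<circ> g = g \<circ> \<omega>" "\<psi> \<circ> h = h \<circ> \<psi>"
    and D_k: "tensor_map s t g h \<circ> D = D \<circ> k"
  shows "tensor_map s t g h \<circ> (tensor_map s t \<omega> \<psi> \<circ> D) = tensor_map s t \<omega> \<psi> \<circ> D \<circ> k"
proof
  fix x
  have "D x \<in> quotient_space (tensor_null s t)" using D by (simp add: linear_into_def)
  note comp = tensor_map_tensor_map[OF this]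
  have "tensor_map s t g h (tensor_map s t \<omega> \<psi> (D x)) =
      tensor_map s t \<omega> \<psi> (tensor_map s t g h (D x))"
    using assms(6,7) by (simp add: comp assms(2-5) fun_eq_iff)
  then show "(tensor_map s t g h \<circ> (tensor_map s t \<omega> \<psi> \<circ> D)) x = (tensor_map s t \<omega> \<psi> \<circ> D \<circ> k) x"
    using D_k by (simp add: fun_eq_iff)
qed

text \<open>
  Both sides equal \<open>\<omega>\<^sup>2 \<otimes> \<omega>\<psi> \<otimes> \<psi>\<^sup>2\<close> applied to the two sides of the untwisted identity.
\<close>

lemma coassoc_twist:
  assumes D: "linear_into u (tensor_null r s) D" and F: "linear_into m (tensor_null u t) F"
    and G: "linear_into v (tensor_null s t) G" and H: "linear_into m (tensor_null r v) H"
    and \<omega>r: "Vector_Spaces.linear r r \<omega>r" and \<omega>s: "Vector_Spaces.linear s s \<omega>s"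
    and \<omega>u: "Vector_Spaces.linear u u \<omega>u" and \<psi>s: "Vector_Spaces.linear s s \<psi>s"
    and \<psi>t: "Vector_Spaces.linear t t \<psi>t" and \<psi>v: "Vector_Spaces.linear v v \<psi>v"
    and D_\<omega>: "tensor_map r s \<omega>r \<omega>s \<circ> D = D \<circ> \<omega>u" and G_\<psi>: "tensor_map s t \<psi>s \<psi>t \<circ> G = G \<circ> \<psi>v"
    and comm: "\<psi>s \<circ> \<omega>s = \<omega>s \<circ> \<psi>s"
    and coassoc: "tensor_map_left r s t D id \<circ> F = tensor_map_right r s t id G \<circ> H"
  shows "tensor_map_left r s t (tensor_map r s \<omega>r \<psi>s \<circ> D) \<psi>t \<circ> (tensor_map u t \<omega>u \<psi>t \<circ> F) =
         tensor_map_right r s t \<omega>r (tensor_map s t \<omega>s \<psi>t \<circ> G) \<circ> (tensor_map r v \<omega>r \<psi>v \<circ> H)"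
proof
  fix x
  have mem: "D a \<in> quotient_space (tensor_null r s)" "F x \<in> quotient_space (tensor_null u t)"
    "G b \<in> quotient_space (tensor_null s t)" "H x \<in> quotient_space (tensor_null r v)" for a b
    using D F G H by (simp_all add: linear_into_def)
  let ?T = "tensor3_map r s t (\<lambda>x. \<omega>r (\<omega>r x)) (\<lambda>x. \<omega>s (\<psi>s x)) (\<lambda>x. \<psi>t (\<psi>t x))"
  have "(tensor_map r s \<omega>r \<psi>s \<circ> D) (\<omega>u a) =
      tensor_map r s (\<lambda>x. \<omega>r (\<omega>r x)) (\<lambda>x. \<omega>s (\<psi>s x)) (D a)" for a
    using D_\<omega> comm
    by (simp add: fun_eq_iff tensor_map_tensor_map[OF mem(1)] \<omega>r \<omega>s \<psi>s flip: fun_cong[OF D_\<omega>, simplified])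
  then have "tensor_map_left r s t (tensor_map r s \<omega>r \<psi>s \<circ> D) \<psi>t (tensor_map u t \<omega>u \<psi>t (F x)) =
      ?T (tensor_map_left r s t D id (F x))"
    by (rule tensor_map_left_tensor_map[OF mem(2) D linear_into_tensor_map_comp[OF D \<omega>r \<psi>s]
          linear_comp[OF \<omega>r \<omega>r] linear_comp[OF \<psi>s \<omega>s] \<omega>u \<psi>t \<psi>t])
  moreover have "(tensor_map s t \<omega>s \<psi>t \<circ> G) (\<psi>v b) =
      tensor_map s t (\<lambda>x. \<omega>s (\<psi>s x)) (\<lambda>x. \<psi>t (\<psi>t x)) (G b)" for b
    by (simp add: tensor_map_tensor_map[OF mem(3)] \<omega>s \<psi>s \<psi>t flip: fun_cong[OF G_\<psi>, simplified])
  then have "tensor_map_right r s t \<omega>r (tensor_map s t \<omega>s \<psi>t \<circ> G) (tensor_map r v \<omega>r \<psi>v (H x)) =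
      ?T (tensor_map_right r s t id G (H x))"
    by (rule tensor_map_right_tensor_map[OF mem(4) G linear_into_tensor_map_comp[OF G \<omega>s \<psi>t]
          linear_comp[OF \<psi>s \<omega>s] linear_comp[OF \<psi>t \<psi>t] \<omega>r \<psi>v \<omega>r])
  ultimately show "(tensor_map_left r s t (tensor_map r s \<omega>r \<psi>s \<circ> D) \<psi>t \<circ> (tensor_map u t \<omega>u \<psi>t \<circ> F)) x =
      (tensor_map_right r s t \<omega>r (tensor_map s t \<omega>s \<psi>t \<circ> G) \<circ> (tensor_map r v \<omega>r \<psi>v \<circ> H)) x"
    using coassoc by (simp add: fun_eq_iff)
qed

lemma bilinear_map_twist:
  assumes "bilinear_map t1 t2 s h" "Vector_Spaces.linear s1 t1 f" "Vector_Spaces.linear s2 t2 g"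
  shows "bilinear_map s1 s2 s (\<lambda>a b. h (f a) (g b))"
  using assms by (simp add: bilinear_map_def Vector_Spaces.linear_iff)

lemma bihom_algebra_twist:
  assumes A: "bihom_algebra s \<mu> id id"
    and \<alpha>: "algebra_morphism s \<mu> \<alpha>" and \<beta>: "algebra_morphism s \<mu> \<beta>" and comm: "\<alpha> \<circ> \<beta> = \<beta> \<circ> \<alpha>"
  shows "bihom_algebra s (\<lambda>a b. \<mu> (\<alpha> a) (\<beta> b)) \<alpha> \<beta>"
proof -
  interpret A: bihom_algebra s \<mu> id id by fact
  have \<beta>\<alpha>: "\<beta> (\<alpha> a) = \<alpha> (\<beta> a)" for a
    using comm by (simp add: fun_eq_iff)
  show ?thesis
    using \<alpha> \<beta> comm A.bihom_assoc
    by (intro bihom_algebra.intro bihom_algebra_axioms.intro A.vector_space_axioms)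
      (simp_all add: algebra_morphism_def \<beta>\<alpha> bilinear_map_twist[OF A.mult_bilinear])
qed

lemma bihom_coalgebra_twist:
  assumes C: "bihom_coalgebra s \<Delta> id id"
    and \<psi>: "coalgebra_morphism s \<Delta> \<psi>" and \<omega>: "coalgebra_morphism s \<Delta> \<omega>"
    and comm: "\<psi> \<circ> \<omega> = \<omega> \<circ> \<psi>"
  shows "bihom_coalgebra s (tensor_map s s \<omega> \<psi> \<circ> \<Delta>) \<psi> \<omega>"
proof -
  interpret C: bihom_coalgebra s \<Delta> id id by fact
  note lin = \<psi>[unfolded coalgebra_morphism_def, THEN conjunct1]
    \<omega>[unfolded coalgebra_morphism_def, THEN conjunct1]
  note com = \<psi>[unfolded coalgebra_morphism_def, THEN conjunct2]
    \<omega>[unfolded coalgebra_morphism_def, THEN conjunct2]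
  note \<Delta> = C.comult_linear
  show ?thesis
  proof (intro bihom_coalgebra.intro bihom_coalgebra_axioms.intro C.vector_space_axioms)
    show "linear_into s (tensor_null s s) (tensor_map s s \<omega> \<psi> \<circ> \<Delta>)"
      by (rule linear_into_tensor_map_comp[OF \<Delta>]) (fact lin)+
    show "tensor_map s s \<psi> \<psi> \<circ> (tensor_map s s \<omega> \<psi> \<circ> \<Delta>) = tensor_map s s \<omega> \<psi> \<circ> \<Delta> \<circ> \<psi>"
      "tensor_map s s \<omega> \<omega> \<circ> (tensor_map s s \<omega> \<psi> \<circ> \<Delta>) = tensor_map s s \<omega> \<psi> \<circ> \<Delta> \<circ> \<omega>"
      by (rule tensor_map_comp_commute[OF \<Delta>]; intro lin com comm comm[symmetric] refl)+
    show "tensor_map_left s s s (tensor_map s s \<omega> \<psi> \<circ> \<Delta>) \<psi> \<circ> (tensor_map s s \<omega> \<psi> \<circ> \<Delta>) =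
        tensor_map_right s s s \<omega> (tensor_map s s \<omega> \<psi> \<circ> \<Delta>) \<circ> (tensor_map s s \<omega> \<psi> \<circ> \<Delta>)"
      by (rule coassoc_twist[OF \<Delta> \<Delta> \<Delta> \<Delta>]; intro lin com comm C.bihom_coassoc)
  qed (intro lin comm)+
qed

lemma bihom_bimodule_twist:
  assumes M: "bihom_bimodule s\<^sub>A \<mu> id id s\<^sub>M lact ract id id"
    and \<alpha>A: "algebra_morphism s\<^sub>A \<mu> \<alpha>\<^sub>A" and \<beta>A: "algebra_morphism s\<^sub>A \<mu> \<beta>\<^sub>A"
    and commA: "\<alpha>\<^sub>A \<circ> \<beta>\<^sub>A = \<beta>\<^sub>A \<circ> \<alpha>\<^sub>A"
    and \<alpha>M: "Vector_Spaces.linear s\<^sub>M s\<^sub>M \<alpha>\<^sub>M" and \<beta>M: "Vector_Spaces.linear s\<^sub>M s\<^sub>M \<beta>\<^sub>M"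
    and commM: "\<alpha>\<^sub>M \<circ> \<beta>\<^sub>M = \<beta>\<^sub>M \<circ> \<alpha>\<^sub>M"
    and lact: "\<And>a m. \<alpha>\<^sub>M (lact a m) = lact (\<alpha>\<^sub>A a) (\<alpha>\<^sub>M m)"
      "\<And>a m. \<beta>\<^sub>M (lact a m) = lact (\<beta>\<^sub>A a) (\<beta>\<^sub>M m)"
    and ract: "\<And>m a. \<alpha>\<^sub>M (ract m a) = ract (\<alpha>\<^sub>M m) (\<alpha>\<^sub>A a)"
      "\<And>m a. \<beta>\<^sub>M (ract m a) = ract (\<beta>\<^sub>M m) (\<beta>\<^sub>A a)"
  shows "bihom_bimodule s\<^sub>A (\<lambda>a b. \<mu> (\<alpha>\<^sub>A a) (\<beta>\<^sub>A b)) \<alpha>\<^sub>A \<beta>\<^sub>A s\<^sub>M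
    (\<lambda>a m. lact (\<alpha>\<^sub>A a) (\<beta>\<^sub>M m)) (\<lambda>m a. ract (\<alpha>\<^sub>M m) (\<beta>\<^sub>A a)) \<alpha>\<^sub>M \<beta>\<^sub>M"
proof -
  interpret M: bihom_bimodule s\<^sub>A \<mu> id id s\<^sub>M lact ract id id by fact
  have \<beta>\<alpha>: "\<beta>\<^sub>A (\<alpha>\<^sub>A a) = \<alpha>\<^sub>A (\<beta>\<^sub>A a)" "\<beta>\<^sub>M (\<alpha>\<^sub>M m) = \<alpha>\<^sub>M (\<beta>\<^sub>M m)" for a m
    using commA commM by (simp_all add: fun_eq_iff)
  show ?thesis
    using \<alpha>A \<beta>A \<alpha>M \<beta>M commM M.lact_lact M.ract_ract M.lact_ract
    by (intro bihom_bimodule.intro bihom_algebra_twist[OF M.A.bihom_algebra_axioms] commA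
        bihom_bimodule_axioms.intro M.M.vector_space_axioms)
      (simp_all add: algebra_morphism_def \<beta>\<alpha> lact ract bilinear_map_twist[OF M.lact_bilinear]
        bilinear_map_twist[OF M.ract_bilinear])
qed

lemma bihom_bicomodule_twist:
  assumes M: "bihom_bicomodule s\<^sub>A \<Delta> id id s\<^sub>M \<rho> \<phi> id id"
    and \<psi>A: "coalgebra_morphism s\<^sub>A \<Delta> \<psi>\<^sub>A" and \<omega>A: "coalgebra_morphism s\<^sub>A \<Delta> \<omega>\<^sub>A"
    and commA: "\<psi>\<^sub>A \<circ> \<omega>\<^sub>A = \<omega>\<^sub>A \<circ> \<psi>\<^sub>A"
    and linM: "Vector_Spaces.linear s\<^sub>M s\<^sub>M \<psi>\<^sub>M" "Vector_Spaces.linear s\<^sub>M s\<^sub>M \<omega>\<^sub>M"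
    and commM: "\<psi>\<^sub>M \<circ> \<omega>\<^sub>M = \<omega>\<^sub>M \<circ> \<psi>\<^sub>M"
    and \<rho>: "tensor_map s\<^sub>A s\<^sub>M \<psi>\<^sub>A \<psi>\<^sub>M \<circ> \<rho> = \<rho> \<circ> \<psi>\<^sub>M" "tensor_map s\<^sub>A s\<^sub>M \<omega>\<^sub>A \<omega>\<^sub>M \<circ> \<rho> = \<rho> \<circ> \<omega>\<^sub>M"
    and \<phi>: "tensor_map s\<^sub>M s\<^sub>A \<psi>\<^sub>M \<psi>\<^sub>A \<circ> \<phi> = \<phi> \<circ> \<psi>\<^sub>M" "tensor_map s\<^sub>M s\<^sub>A \<omega>\<^sub>M \<omega>\<^sub>A \<circ> \<phi> = \<phi> \<circ> \<omega>\<^sub>M"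
  shows "bihom_bicomodule s\<^sub>A (tensor_map s\<^sub>A s\<^sub>A \<omega>\<^sub>A \<psi>\<^sub>A \<circ> \<Delta>) \<psi>\<^sub>A \<omega>\<^sub>A s\<^sub>M
    (tensor_map s\<^sub>A s\<^sub>M \<omega>\<^sub>A \<psi>\<^sub>M \<circ> \<rho>) (tensor_map s\<^sub>M s\<^sub>A \<omega>\<^sub>M \<psi>\<^sub>A \<circ> \<phi>) \<psi>\<^sub>M \<omega>\<^sub>M"
proof -
  interpret M: bihom_bicomodule s\<^sub>A \<Delta> id id s\<^sub>M \<rho> \<phi> id id by fact
  note lin = linM \<psi>A[unfolded coalgebra_morphism_def, THEN conjunct1]
    \<omega>A[unfolded coalgebra_morphism_def, THEN conjunct1]
  note com = \<psi>A[unfolded coalgebra_morphism_def, THEN conjunct2]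
    \<omega>A[unfolded coalgebra_morphism_def, THEN conjunct2] \<rho> \<phi>
  note into = M.A.comult_linear M.rho_linear M.phi_linear
  note comm = commA commM commA[symmetric] commM[symmetric] refl
  let ?\<Delta> = "tensor_map s\<^sub>A s\<^sub>A \<omega>\<^sub>A \<psi>\<^sub>A \<circ> \<Delta>"
  let ?\<rho> = "tensor_map s\<^sub>A s\<^sub>M \<omega>\<^sub>A \<psi>\<^sub>M \<circ> \<rho>" and ?\<phi> = "tensor_map s\<^sub>M s\<^sub>A \<omega>\<^sub>M \<psi>\<^sub>A \<circ> \<phi>"
  show ?thesis
  proof (intro bihom_bicomodule.intro bihom_bicomodule_axioms.intro M.M.vector_space_axioms)
    show "bihom_coalgebra s\<^sub>A ?\<Delta> \<psi>\<^sub>A \<omega>\<^sub>A"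
      by (rule bihom_coalgebra_twist[OF M.A.bihom_coalgebra_axioms \<psi>A \<omega>A commA])
    show "linear_into s\<^sub>M (tensor_null s\<^sub>A s\<^sub>M) ?\<rho>" "linear_into s\<^sub>M (tensor_null s\<^sub>M s\<^sub>A) ?\<phi>"
      by (rule linear_into_tensor_map_comp, rule into, (fact lin)+)+
    show "tensor_map s\<^sub>A s\<^sub>M \<psi>\<^sub>A \<psi>\<^sub>M \<circ> ?\<rho> = ?\<rho> \<circ> \<psi>\<^sub>M" "tensor_map s\<^sub>A s\<^sub>M \<omega>\<^sub>A \<omega>\<^sub>M \<circ> ?\<rho> = ?\<rho> \<circ> \<omega>\<^sub>M"
      "tensor_map s\<^sub>M s\<^sub>A \<psi>\<^sub>M \<psi>\<^sub>A \<circ> ?\<phi> = ?\<phi> \<circ> \<psi>\<^sub>M" "tensor_map s\<^sub>M s\<^sub>A \<omega>\<^sub>M \<omega>\<^sub>A \<circ> ?\<phi> = ?\<phi> \<circ> \<omega>\<^sub>M"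
      by (rule tensor_map_comp_commute, rule into, (intro lin com comm)+)+
    show "tensor_map_right s\<^sub>A s\<^sub>A s\<^sub>M \<omega>\<^sub>A ?\<rho> \<circ> ?\<rho> = tensor_map_left s\<^sub>A s\<^sub>A s\<^sub>M ?\<Delta> \<psi>\<^sub>M \<circ> ?\<rho>"
      by (rule coassoc_twist[OF M.A.comult_linear M.rho_linear M.rho_linear M.rho_linear, symmetric];
          intro lin com commA commM M.rho_coassoc[symmetric])
    show "tensor_map_right s\<^sub>M s\<^sub>A s\<^sub>A \<omega>\<^sub>M ?\<Delta> \<circ> ?\<phi> = tensor_map_left s\<^sub>M s\<^sub>A s\<^sub>A ?\<phi> \<psi>\<^sub>A \<circ> ?\<phi>"
      by (rule coassoc_twist[OF M.phi_linear M.phi_linear M.A.comult_linear M.phi_linear, symmetric];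
          intro lin com commA commM M.phi_coassoc[symmetric])
    show "tensor_map_right s\<^sub>A s\<^sub>M s\<^sub>A \<omega>\<^sub>A ?\<phi> \<circ> ?\<rho> = tensor_map_left s\<^sub>A s\<^sub>M s\<^sub>A ?\<rho> \<psi>\<^sub>A \<circ> ?\<phi>"
      by (rule coassoc_twist[OF M.rho_linear M.phi_linear M.phi_linear M.rho_linear, symmetric];
          intro lin com commA commM M.rho_phi_coassoc[symmetric])
  qed (intro lin commM)+
qed

lemma coset_linear_combination:
  assumes N: "free.subspace N" and F: "coset_linear N N' F"
    and "X \<in> quotient_space N" "Y \<in> quotient_space N" "Z \<in> quotient_space N"
  shows "F (X + Y + coset_scale N c Z) = F X + F Y + coset_scale N' c (F Z)"
proof -
  have "X + Y \<in> quotient_space N" "coset_scale N c Z \<in> quotient_space N"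
    using assms(3-5)
    by (auto simp: quotient_space_def coset_plus[OF N] coset_scale_coset[OF N])
  then show ?thesis using F assms(3-5) by (simp add: coset_linear_def)
qed

lemma tensor_map_in_quotient_space:
  assumes "X \<in> quotient_space (tensor_null s1 s2)"
    and "Vector_Spaces.linear s1 t1 f" "Vector_Spaces.linear s2 t2 g"
  shows "tensor_map t1 t2 f g X \<in> quotient_space (tensor_null t1 t2)"
  using coset_linear_tensor_map[OF assms(2,3)] assms(1) by (simp add: coset_linear_def)

lemma tensor_in_quotient_space: "tensor s1 s2 a b \<in> quotient_space (tensor_null s1 s2)"
  by (simp add: quotient_space_def tensor_def)

lemma tensor_map_comp3_eq_comp2:
  assumes X: "X \<in> quotient_space (tensor_null s1 s2)"
    and f: "Vector_Spaces.linear s1 r1 f1" "Vector_Spaces.linear r1 t1 f2" "Vector_Spaces.linear t1 u1 f3"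
    and g: "Vector_Spaces.linear s2 r2 g1" "Vector_Spaces.linear r2 t2 g2" "Vector_Spaces.linear t2 u2 g3"
    and h: "Vector_Spaces.linear s1 v1 h1" "Vector_Spaces.linear v1 u1 h2"
    and k: "Vector_Spaces.linear s2 v2 k1" "Vector_Spaces.linear v2 u2 k2"
    and eq: "\<And>x. f3 (f2 (f1 x)) = h2 (h1 x)" "\<And>y. g3 (g2 (g1 y)) = k2 (k1 y)"
  shows "tensor_map u1 u2 f3 g3 (tensor_map t1 t2 f2 g2 (tensor_map r1 r2 f1 g1 X)) =
         tensor_map u1 u2 h2 k2 (tensor_map v1 v2 h1 k1 X)"
  by (simp add: tensor_map_tensor_map[OF X f(1) g(1) f(2) g(2)] tensor_map_tensor_map[OF X h(1) k(1) h(2) k(2)]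
      tensor_map_tensor_map[OF X linear_comp[OF f(1,2)] linear_comp[OF g(1,2)] f(3) g(3)] eq)

lemma infBH_bialgebra_twist:
  assumes "inf_bialgebra lam s \<mu> \<Delta>"
    and morph: "\<forall>f \<in> {\<alpha>, \<beta>, \<psi>, \<omega>}. algebra_morphism s \<mu> f \<and> coalgebra_morphism s \<Delta> f"
    and comm: "pairwise_commute {\<alpha>, \<beta>, \<psi>, \<omega>}"
  shows "infBH_bialgebra lam s (\<lambda>a b. \<mu> (\<alpha> a) (\<beta> b)) (tensor_map s s \<omega> \<psi> \<circ> \<Delta>) \<alpha> \<beta> \<psi> \<omega>"
proof -
  interpret A: infBH_bialgebra lam s \<mu> \<Delta> id id id id
    using assms(1) by (simp add: inf_bialgebra_def)
  have alg: "algebra_morphism s \<mu> f" and coalg: "coalgebra_morphism s \<Delta> f"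
    if "f \<in> {\<alpha>, \<beta>, \<psi>, \<omega>}" for f
    using morph that by auto
  have cc: "f \<circ> g = g \<circ> f" if "f \<in> {\<alpha>, \<beta>, \<psi>, \<omega>}" "g \<in> {\<alpha>, \<beta>, \<psi>, \<omega>}" for f g
    using comm that by (auto simp: pairwise_commute_def)
  have lin: "Vector_Spaces.linear s s f" and mult: "f (\<mu> a b) = \<mu> (f a) (f b)"
    and com: "tensor_map s s f f \<circ> \<Delta> = \<Delta> \<circ> f"
    if "f \<in> {\<alpha>, \<beta>, \<psi>, \<omega>}" for f a b
    using alg[OF that] coalg[OF that] by (auto simp: algebra_morphism_def coalgebra_morphism_def)
  have com': "\<Delta> (f a) = tensor_map s s f f (\<Delta> a)" if "f \<in> {\<alpha>, \<beta>, \<psi>, \<omega>}" for f a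
    using com[OF that] by (simp add: fun_eq_iff)
  have swap: "f (g a) = g (f a)" if "f \<in> {\<alpha>, \<beta>, \<psi>, \<omega>}" "g \<in> {\<alpha>, \<beta>, \<psi>, \<omega>}" for f g a
    using cc[OF that] by (simp add: fun_eq_iff)
  have \<Delta>: "\<Delta> a \<in> quotient_space (tensor_null s s)" for a
    using A.comult_linear by (simp add: linear_into_def)
  have commutes: "\<beta> (\<alpha> x) = \<alpha> (\<beta> x)" "\<psi> (\<alpha> x) = \<alpha> (\<psi> x)" "\<omega> (\<alpha> x) = \<alpha> (\<omega> x)"
    "\<psi> (\<beta> x) = \<beta> (\<psi> x)" "\<omega> (\<beta> x) = \<beta> (\<omega> x)" "\<omega> (\<psi> x) = \<psi> (\<omega> x)" for x
    by (rule swap; simp)+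
  interpret B: bihom_algebra s "\<lambda>a b. \<mu> (\<alpha> a) (\<beta> b)" \<alpha> \<beta>
    by (intro bihom_algebra_twist[OF A.bihom_algebra_axioms] alg cc) simp_all
  interpret C: bihom_coalgebra s "tensor_map s s \<omega> \<psi> \<circ> \<Delta>" \<psi> \<omega>
    by (intro bihom_coalgebra_twist[OF A.bihom_coalgebra_axioms] coalg cc) simp_all
  note bilin = A.mult_bilinear[unfolded bilinear_map_def] B.mult_bilinear[unfolded bilinear_map_def]
  note \<omega>\<psi> = coset_linear_tensor_map[OF lin[of \<omega>] lin[of \<psi>], simplified]
  show ?thesis
  proof (intro infBH_bialgebra.intro infBH_bialgebra_axioms.intro
      B.bihom_algebra_axioms C.bihom_coalgebra_axioms)
    show "tensor_map s s \<alpha> \<alpha> \<circ> (tensor_map s s \<omega> \<psi> \<circ> \<Delta>) = tensor_map s s \<omega> \<psi> \<circ> \<Delta> \<circ> \<alpha>"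
      "tensor_map s s \<beta> \<beta> \<circ> (tensor_map s s \<omega> \<psi> \<circ> \<Delta>) = tensor_map s s \<omega> \<psi> \<circ> \<Delta> \<circ> \<beta>"
      by (rule tensor_map_comp_commute[OF A.comult_linear]; intro lin com cc; simp)+
  next
    fix a b
    have "tensor_map s s \<omega> \<psi> (tensor_map s s (\<mu> (\<alpha> a)) id (tensor_map s s \<beta> \<beta> (\<Delta> b))) =
        tensor_map s s (\<lambda>y. \<mu> (\<alpha> (\<omega> a)) (\<beta> y)) \<beta> (tensor_map s s \<omega> \<psi> (\<Delta> b))"
      "tensor_map s s \<omega> \<psi> (tensor_map s s id (\<lambda>x. \<mu> x (\<beta> b)) (tensor_map s s \<alpha> \<alpha> (\<Delta> a))) =
        tensor_map s s \<alpha> (\<lambda>x. \<mu> (\<alpha> x) (\<beta> (\<psi> b))) (tensor_map s s \<omega> \<psi> (\<Delta> a))"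
      by (rule tensor_map_comp3_eq_comp2[OF \<Delta>]; simp add: lin mult commutes bilin A.alpha_linear)+
    then show "(tensor_map s s \<omega> \<psi> \<circ> \<Delta>) (\<mu> (\<alpha> a) (\<beta> b)) =
        tensor_map s s (\<lambda>y. \<mu> (\<alpha> (\<omega> a)) (\<beta> y)) \<beta> ((tensor_map s s \<omega> \<psi> \<circ> \<Delta>) b)
        + tensor_map s s \<alpha> (\<lambda>x. \<mu> (\<alpha> x) (\<beta> (\<psi> b))) ((tensor_map s s \<omega> \<psi> \<circ> \<Delta>) a)
        + coset_scale (tensor_null s s) lam (tensor s s (\<alpha> (\<omega> a)) (\<beta> (\<psi> b)))"
      by (simp add: A.comult_mult com' coset_linear_combination[OF subspace_tensor_null \<omega>\<psi>]
          tensor_map_in_quotient_space[of _ s s] tensor_in_quotient_space \<Delta> lin bilin A.alpha_linear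
          tensor_map_tensor[of s _ _ s] commutes)
  qed (simp_all add: cc mult commutes)
qed

theorem theorem2p10:
  fixes lam :: "'k::field"
    and s\<^sub>A :: "'k \<Rightarrow> 'a \<Rightarrow> 'a::ab_group_add" and \<mu> :: "'a \<Rightarrow> 'a \<Rightarrow> 'a"
    and \<Delta> :: "'a \<Rightarrow> ('a \<times> 'a \<Rightarrow>\<^sub>0 'k) set"
    and s\<^sub>M :: "'k \<Rightarrow> 'm \<Rightarrow> 'm::ab_group_add"
    and lact :: "'a \<Rightarrow> 'm \<Rightarrow> 'm" and ract :: "'m \<Rightarrow> 'a \<Rightarrow> 'm"
    and \<rho> :: "'m \<Rightarrow> ('a \<times> 'm \<Rightarrow>\<^sub>0 'k) set" and \<phi> :: "'m \<Rightarrow> ('m \<times> 'a \<Rightarrow>\<^sub>0 'k) set"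
    and \<alpha>\<^sub>A \<beta>\<^sub>A \<psi>\<^sub>A \<omega>\<^sub>A :: "'a \<Rightarrow> 'a" and \<alpha>\<^sub>M \<beta>\<^sub>M \<psi>\<^sub>M \<omega>\<^sub>M :: "'m \<Rightarrow> 'm"
  assumes "inf_bialgebra lam s\<^sub>A \<mu> \<Delta>"
    and "inf_Hopf_bimodule lam s\<^sub>A \<mu> \<Delta> s\<^sub>M lact ract \<rho> \<phi>"
    and "\<forall>f \<in> {\<alpha>\<^sub>A, \<beta>\<^sub>A, \<psi>\<^sub>A, \<omega>\<^sub>A}. algebra_morphism s\<^sub>A \<mu> f \<and> coalgebra_morphism s\<^sub>A \<Delta> f"
    and "pairwise_commute {\<alpha>\<^sub>A, \<beta>\<^sub>A, \<psi>\<^sub>A, \<omega>\<^sub>A}"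
    and "\<forall>f \<in> {\<alpha>\<^sub>M, \<beta>\<^sub>M, \<psi>\<^sub>M, \<omega>\<^sub>M}. Vector_Spaces.linear s\<^sub>M s\<^sub>M f"
    and "pairwise_commute {\<alpha>\<^sub>M, \<beta>\<^sub>M, \<psi>\<^sub>M, \<omega>\<^sub>M}"
    and "\<forall>(f\<^sub>A, f\<^sub>M) \<in> {(\<alpha>\<^sub>A, \<alpha>\<^sub>M), (\<beta>\<^sub>A, \<beta>\<^sub>M), (\<psi>\<^sub>A, \<psi>\<^sub>M), (\<omega>\<^sub>A, \<omega>\<^sub>M)}.
           (\<forall>a m. f\<^sub>M (lact a m) = lact (f\<^sub>A a) (f\<^sub>M m)) \<and>
           (\<forall>m a. f\<^sub>M (ract m a) = ract (f\<^sub>M m) (f\<^sub>A a)) \<and>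
           \<rho> \<circ> f\<^sub>M = tensor_map s\<^sub>A s\<^sub>M f\<^sub>A f\<^sub>M \<circ> \<rho> \<and>
           \<phi> \<circ> f\<^sub>M = tensor_map s\<^sub>M s\<^sub>A f\<^sub>M f\<^sub>A \<circ> \<phi>"
  shows "infBH_bialgebra lam s\<^sub>A
           (\<lambda>a b. \<mu> (\<alpha>\<^sub>A a) (\<beta>\<^sub>A b)) (tensor_map s\<^sub>A s\<^sub>A \<omega>\<^sub>A \<psi>\<^sub>A \<circ> \<Delta>) \<alpha>\<^sub>A \<beta>\<^sub>A \<psi>\<^sub>A \<omega>\<^sub>A
         \<and> infBH_Hopf_bimodule lam s\<^sub>A
           (\<lambda>a b. \<mu> (\<alpha>\<^sub>A a) (\<beta>\<^sub>A b)) (tensor_map s\<^sub>A s\<^sub>A \<omega>\<^sub>A \<psi>\<^sub>A \<circ> \<Delta>) \<alpha>\<^sub>A \<beta>\<^sub>A \<psi>\<^sub>A \<omega>\<^sub>A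
           s\<^sub>M
           (\<lambda>a m. lact (\<alpha>\<^sub>A a) (\<beta>\<^sub>M m)) (\<lambda>m a. ract (\<alpha>\<^sub>M m) (\<beta>\<^sub>A a))
           (tensor_map s\<^sub>A s\<^sub>M \<omega>\<^sub>A \<psi>\<^sub>M \<circ> \<rho>) (tensor_map s\<^sub>M s\<^sub>A \<omega>\<^sub>M \<psi>\<^sub>A \<circ> \<phi>)
           \<alpha>\<^sub>M \<beta>\<^sub>M \<psi>\<^sub>M \<omega>\<^sub>M"
proof
  show twist: "infBH_bialgebra lam s\<^sub>A
      (\<lambda>a b. \<mu> (\<alpha>\<^sub>A a) (\<beta>\<^sub>A b)) (tensor_map s\<^sub>A s\<^sub>A \<omega>\<^sub>A \<psi>\<^sub>A \<circ> \<Delta>) \<alpha>\<^sub>A \<beta>\<^sub>A \<psi>\<^sub>A \<omega>\<^sub>A"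
    using assms(1,3,4) by (rule infBH_bialgebra_twist)
  interpret H: infBH_Hopf_bimodule lam s\<^sub>A \<mu> \<Delta> id id id id s\<^sub>M lact ract \<rho> \<phi> id id id id
    using assms(2) by (simp add: inf_Hopf_bimodule_def)
  have algA: "algebra_morphism s\<^sub>A \<mu> f" and coalgA: "coalgebra_morphism s\<^sub>A \<Delta> f"
    if "f \<in> {\<alpha>\<^sub>A, \<beta>\<^sub>A, \<psi>\<^sub>A, \<omega>\<^sub>A}" for f
    using assms(3) that by auto
  have ccA: "f \<circ> g = g \<circ> f" if "f \<in> {\<alpha>\<^sub>A, \<beta>\<^sub>A, \<psi>\<^sub>A, \<omega>\<^sub>A}" "g \<in> {\<alpha>\<^sub>A, \<beta>\<^sub>A, \<psi>\<^sub>A, \<omega>\<^sub>A}" for f g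
    using assms(4) that by (auto simp: pairwise_commute_def)
  have ccM: "f \<circ> g = g \<circ> f" if "f \<in> {\<alpha>\<^sub>M, \<beta>\<^sub>M, \<psi>\<^sub>M, \<omega>\<^sub>M}" "g \<in> {\<alpha>\<^sub>M, \<beta>\<^sub>M, \<psi>\<^sub>M, \<omega>\<^sub>M}" for f g
    using assms(6) that by (auto simp: pairwise_commute_def)
  have linA: "Vector_Spaces.linear s\<^sub>A s\<^sub>A f" and mult: "f (\<mu> a b) = \<mu> (f a) (f b)"
    and com\<Delta>: "\<Delta> (f a) = tensor_map s\<^sub>A s\<^sub>A f f (\<Delta> a)"
    if "f \<in> {\<alpha>\<^sub>A, \<beta>\<^sub>A, \<psi>\<^sub>A, \<omega>\<^sub>A}" for f a b
    using algA[OF that] coalgA[OF that]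
    by (auto simp: algebra_morphism_def coalgebra_morphism_def fun_eq_iff)
  have linM: "Vector_Spaces.linear s\<^sub>M s\<^sub>M \<alpha>\<^sub>M" "Vector_Spaces.linear s\<^sub>M s\<^sub>M \<beta>\<^sub>M"
    "Vector_Spaces.linear s\<^sub>M s\<^sub>M \<psi>\<^sub>M" "Vector_Spaces.linear s\<^sub>M s\<^sub>M \<omega>\<^sub>M"
    using assms(5) by simp_all
  have lact: "\<alpha>\<^sub>M (lact a m) = lact (\<alpha>\<^sub>A a) (\<alpha>\<^sub>M m)" "\<beta>\<^sub>M (lact a m) = lact (\<beta>\<^sub>A a) (\<beta>\<^sub>M m)"
    "\<psi>\<^sub>M (lact a m) = lact (\<psi>\<^sub>A a) (\<psi>\<^sub>M m)" "\<omega>\<^sub>M (lact a m) = lact (\<omega>\<^sub>A a) (\<omega>\<^sub>M m)" for a m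
    using assms(7) by simp_all
  have ract: "\<alpha>\<^sub>M (ract m a) = ract (\<alpha>\<^sub>M m) (\<alpha>\<^sub>A a)" "\<beta>\<^sub>M (ract m a) = ract (\<beta>\<^sub>M m) (\<beta>\<^sub>A a)"
    "\<psi>\<^sub>M (ract m a) = ract (\<psi>\<^sub>M m) (\<psi>\<^sub>A a)" "\<omega>\<^sub>M (ract m a) = ract (\<omega>\<^sub>M m) (\<omega>\<^sub>A a)" for a m
    using assms(7) by simp_all
  have \<rho>: "\<rho> \<circ> \<alpha>\<^sub>M = tensor_map s\<^sub>A s\<^sub>M \<alpha>\<^sub>A \<alpha>\<^sub>M \<circ> \<rho>" "\<rho> \<circ> \<beta>\<^sub>M = tensor_map s\<^sub>A s\<^sub>M \<beta>\<^sub>A \<beta>\<^sub>M \<circ> \<rho>"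
    "\<rho> \<circ> \<psi>\<^sub>M = tensor_map s\<^sub>A s\<^sub>M \<psi>\<^sub>A \<psi>\<^sub>M \<circ> \<rho>" "\<rho> \<circ> \<omega>\<^sub>M = tensor_map s\<^sub>A s\<^sub>M \<omega>\<^sub>A \<omega>\<^sub>M \<circ> \<rho>"
    using assms(7) by blast+
  have \<phi>: "\<phi> \<circ> \<alpha>\<^sub>M = tensor_map s\<^sub>M s\<^sub>A \<alpha>\<^sub>M \<alpha>\<^sub>A \<circ> \<phi>" "\<phi> \<circ> \<beta>\<^sub>M = tensor_map s\<^sub>M s\<^sub>A \<beta>\<^sub>M \<beta>\<^sub>A \<circ> \<phi>"
    "\<phi> \<circ> \<psi>\<^sub>M = tensor_map s\<^sub>M s\<^sub>A \<psi>\<^sub>M \<psi>\<^sub>A \<circ> \<phi>" "\<phi> \<circ> \<omega>\<^sub>M = tensor_map s\<^sub>M s\<^sub>A \<omega>\<^sub>M \<omega>\<^sub>A \<circ> \<phi>"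
    using assms(7) by blast+
  have swapA: "f (g a) = g (f a)" if "f \<in> {\<alpha>\<^sub>A, \<beta>\<^sub>A, \<psi>\<^sub>A, \<omega>\<^sub>A}" "g \<in> {\<alpha>\<^sub>A, \<beta>\<^sub>A, \<psi>\<^sub>A, \<omega>\<^sub>A}" for f g a
    using ccA[OF that] by (simp add: fun_eq_iff)
  have commutesA: "\<beta>\<^sub>A (\<alpha>\<^sub>A x) = \<alpha>\<^sub>A (\<beta>\<^sub>A x)" "\<psi>\<^sub>A (\<alpha>\<^sub>A x) = \<alpha>\<^sub>A (\<psi>\<^sub>A x)" "\<omega>\<^sub>A (\<alpha>\<^sub>A x) = \<alpha>\<^sub>A (\<omega>\<^sub>A x)"
    "\<psi>\<^sub>A (\<beta>\<^sub>A x) = \<beta>\<^sub>A (\<psi>\<^sub>A x)" "\<omega>\<^sub>A (\<beta>\<^sub>A x) = \<beta>\<^sub>A (\<omega>\<^sub>A x)" "\<omega>\<^sub>A (\<psi>\<^sub>A x) = \<psi>\<^sub>A (\<omega>\<^sub>A x)" for x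
    by (rule swapA; simp)+
  have swapM: "f (g a) = g (f a)" if "f \<in> {\<alpha>\<^sub>M, \<beta>\<^sub>M, \<psi>\<^sub>M, \<omega>\<^sub>M}" "g \<in> {\<alpha>\<^sub>M, \<beta>\<^sub>M, \<psi>\<^sub>M, \<omega>\<^sub>M}" for f g a
    using ccM[OF that] by (simp add: fun_eq_iff)
  have commutesM: "\<beta>\<^sub>M (\<alpha>\<^sub>M x) = \<alpha>\<^sub>M (\<beta>\<^sub>M x)" "\<psi>\<^sub>M (\<alpha>\<^sub>M x) = \<alpha>\<^sub>M (\<psi>\<^sub>M x)" "\<omega>\<^sub>M (\<alpha>\<^sub>M x) = \<alpha>\<^sub>M (\<omega>\<^sub>M x)"
    "\<psi>\<^sub>M (\<beta>\<^sub>M x) = \<beta>\<^sub>M (\<psi>\<^sub>M x)" "\<omega>\<^sub>M (\<beta>\<^sub>M x) = \<beta>\<^sub>M (\<omega>\<^sub>M x)" "\<omega>\<^sub>M (\<psi>\<^sub>M x) = \<psi>\<^sub>M (\<omega>\<^sub>M x)" for x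
    by (rule swapM; simp)+
  have mem: "\<Delta> a \<in> quotient_space (tensor_null s\<^sub>A s\<^sub>A)" "\<rho> m \<in> quotient_space (tensor_null s\<^sub>A s\<^sub>M)"
    "\<phi> m \<in> quotient_space (tensor_null s\<^sub>M s\<^sub>A)" for a m
    using H.comult_linear H.rho_linear H.phi_linear by (simp_all add: linear_into_def)
  interpret A: infBH_bialgebra lam s\<^sub>A "\<lambda>a b. \<mu> (\<alpha>\<^sub>A a) (\<beta>\<^sub>A b)"
      "tensor_map s\<^sub>A s\<^sub>A \<omega>\<^sub>A \<psi>\<^sub>A \<circ> \<Delta>" \<alpha>\<^sub>A \<beta>\<^sub>A \<psi>\<^sub>A \<omega>\<^sub>A
    by (rule twist)
  interpret B: bihom_bimodule s\<^sub>A "\<lambda>a b. \<mu> (\<alpha>\<^sub>A a) (\<beta>\<^sub>A b)" \<alpha>\<^sub>A \<beta>\<^sub>A s\<^sub>M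
      "\<lambda>a m. lact (\<alpha>\<^sub>A a) (\<beta>\<^sub>M m)" "\<lambda>m a. ract (\<alpha>\<^sub>M m) (\<beta>\<^sub>A a)" \<alpha>\<^sub>M \<beta>\<^sub>M
    by (intro bihom_bimodule_twist[OF H.bihom_bimodule_axioms] algA ccA ccM linM lact ract) simp_all
  let ?\<Delta> = "tensor_map s\<^sub>A s\<^sub>A \<omega>\<^sub>A \<psi>\<^sub>A \<circ> \<Delta>"
  let ?\<rho> = "tensor_map s\<^sub>A s\<^sub>M \<omega>\<^sub>A \<psi>\<^sub>M \<circ> \<rho>" and ?\<phi> = "tensor_map s\<^sub>M s\<^sub>A \<omega>\<^sub>M \<psi>\<^sub>A \<circ> \<phi>"
  have bicomodule: "bihom_bicomodule s\<^sub>A ?\<Delta> \<psi>\<^sub>A \<omega>\<^sub>A s\<^sub>M ?\<rho> ?\<phi> \<psi>\<^sub>M \<omega>\<^sub>M"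
    by (intro bihom_bicomodule_twist[OF H.bihom_bicomodule_axioms] coalgA ccA ccM linM
        \<rho>[symmetric] \<phi>[symmetric]) simp_all
  note bilin = H.mult_bilinear[unfolded bilinear_map_def] H.lact_bilinear[unfolded bilinear_map_def]
    H.ract_bilinear[unfolded bilinear_map_def] A.mult_bilinear[unfolded bilinear_map_def]
    B.lact_bilinear[unfolded bilinear_map_def] B.ract_bilinear[unfolded bilinear_map_def]
  note lins = linA linM bilin H.alpha_linear H.alphaM_linear
  note \<omega>\<psi> = coset_linear_tensor_map[OF linA[of \<omega>\<^sub>A] linM(3), simplified]
    coset_linear_tensor_map[OF linM(4) linA[of \<psi>\<^sub>A], simplified]
  note commutes = commutesA commutesM
  note twists = com\<Delta> \<rho>[unfolded fun_eq_iff, simplified] \<phi>[unfolded fun_eq_iff, simplified]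
  note split = coset_linear_combination[OF subspace_tensor_null \<omega>\<psi>(1)]
    coset_linear_combination[OF subspace_tensor_null \<omega>\<psi>(2)]
  note quot = tensor_in_quotient_space tensor_map_in_quotient_space[OF mem(1)]
    tensor_map_in_quotient_space[OF tensor_map_in_quotient_space[OF mem(1)]]
    tensor_map_in_quotient_space[OF tensor_map_in_quotient_space[OF mem(2)]]
    tensor_map_in_quotient_space[OF tensor_map_in_quotient_space[OF mem(3)]]
  show "infBH_Hopf_bimodule lam s\<^sub>A (\<lambda>a b. \<mu> (\<alpha>\<^sub>A a) (\<beta>\<^sub>A b)) ?\<Delta> \<alpha>\<^sub>A \<beta>\<^sub>A \<psi>\<^sub>A \<omega>\<^sub>A s\<^sub>M
      (\<lambda>a m. lact (\<alpha>\<^sub>A a) (\<beta>\<^sub>M m)) (\<lambda>m a. ract (\<alpha>\<^sub>M m) (\<beta>\<^sub>A a)) ?\<rho> ?\<phi> \<alpha>\<^sub>M \<beta>\<^sub>M \<psi>\<^sub>M \<omega>\<^sub>M"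
  proof (intro infBH_Hopf_bimodule.intro infBH_Hopf_bimodule_axioms.intro twist
      B.bihom_bimodule_axioms bicomodule assms(6))
    fix a m
    have "tensor_map s\<^sub>A s\<^sub>M \<omega>\<^sub>A \<psi>\<^sub>M (tensor_map s\<^sub>A s\<^sub>M (\<mu> (\<alpha>\<^sub>A a)) id (tensor_map s\<^sub>A s\<^sub>M \<beta>\<^sub>A \<beta>\<^sub>M (\<rho> m))) =
        tensor_map s\<^sub>A s\<^sub>M (\<lambda>y. \<mu> (\<alpha>\<^sub>A (\<omega>\<^sub>A a)) (\<beta>\<^sub>A y)) \<beta>\<^sub>M (tensor_map s\<^sub>A s\<^sub>M \<omega>\<^sub>A \<psi>\<^sub>M (\<rho> m))"
      by (rule tensor_map_comp3_eq_comp2[OF mem(2)]; simp add: lins mult commutes)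
    moreover have "tensor_map s\<^sub>A s\<^sub>M \<omega>\<^sub>A \<psi>\<^sub>M
          (tensor_map s\<^sub>A s\<^sub>M id (\<lambda>x. lact x (\<beta>\<^sub>M m)) (tensor_map s\<^sub>A s\<^sub>A \<alpha>\<^sub>A \<alpha>\<^sub>A (\<Delta> a))) =
        tensor_map s\<^sub>A s\<^sub>M \<alpha>\<^sub>A (\<lambda>x. lact (\<alpha>\<^sub>A x) (\<beta>\<^sub>M (\<psi>\<^sub>M m))) (tensor_map s\<^sub>A s\<^sub>A \<omega>\<^sub>A \<psi>\<^sub>A (\<Delta> a))"
      by (rule tensor_map_comp3_eq_comp2[OF mem(1)]; simp add: lins lact commutes)
    ultimately show "?\<rho> (lact (\<alpha>\<^sub>A a) (\<beta>\<^sub>M m)) =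
        tensor_map s\<^sub>A s\<^sub>M (\<lambda>b. \<mu> (\<alpha>\<^sub>A (\<omega>\<^sub>A a)) (\<beta>\<^sub>A b)) \<beta>\<^sub>M (?\<rho> m)
        + tensor_map s\<^sub>A s\<^sub>M \<alpha>\<^sub>A (\<lambda>x. lact (\<alpha>\<^sub>A x) (\<beta>\<^sub>M (\<psi>\<^sub>M m))) (?\<Delta> a)
        + coset_scale (tensor_null s\<^sub>A s\<^sub>M) lam (tensor s\<^sub>A s\<^sub>M (\<alpha>\<^sub>A (\<omega>\<^sub>A a)) (\<beta>\<^sub>M (\<psi>\<^sub>M m)))"
      by (simp add: H.rho_lact twists split quot lins tensor_map_tensor[of s\<^sub>A _ _ s\<^sub>M] commutes)
    have "tensor_map s\<^sub>M s\<^sub>A \<omega>\<^sub>M \<psi>\<^sub>A (tensor_map s\<^sub>M s\<^sub>A (ract (\<alpha>\<^sub>M m)) id (tensor_map s\<^sub>A s\<^sub>A \<beta>\<^sub>A \<beta>\<^sub>A (\<Delta> a))) =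
        tensor_map s\<^sub>M s\<^sub>A (\<lambda>y. ract (\<alpha>\<^sub>M (\<omega>\<^sub>M m)) (\<beta>\<^sub>A y)) \<beta>\<^sub>A (tensor_map s\<^sub>A s\<^sub>A \<omega>\<^sub>A \<psi>\<^sub>A (\<Delta> a))"
      by (rule tensor_map_comp3_eq_comp2[OF mem(1)]; simp add: lins ract commutes)
    moreover have "tensor_map s\<^sub>M s\<^sub>A \<omega>\<^sub>M \<psi>\<^sub>A
          (tensor_map s\<^sub>M s\<^sub>A id (\<lambda>x. \<mu> x (\<beta>\<^sub>A a)) (tensor_map s\<^sub>M s\<^sub>A \<alpha>\<^sub>M \<alpha>\<^sub>A (\<phi> m))) =
        tensor_map s\<^sub>M s\<^sub>A \<alpha>\<^sub>M (\<lambda>x. \<mu> (\<alpha>\<^sub>A x) (\<beta>\<^sub>A (\<psi>\<^sub>A a))) (tensor_map s\<^sub>M s\<^sub>A \<omega>\<^sub>M \<psi>\<^sub>A (\<phi> m))"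
      by (rule tensor_map_comp3_eq_comp2[OF mem(3)]; simp add: lins mult commutes)
    ultimately show "?\<phi> (ract (\<alpha>\<^sub>M m) (\<beta>\<^sub>A a)) =
        tensor_map s\<^sub>M s\<^sub>A (\<lambda>b. ract (\<alpha>\<^sub>M (\<omega>\<^sub>M m)) (\<beta>\<^sub>A b)) \<beta>\<^sub>A (?\<Delta> a)
        + tensor_map s\<^sub>M s\<^sub>A \<alpha>\<^sub>M (\<lambda>x. \<mu> (\<alpha>\<^sub>A x) (\<beta>\<^sub>A (\<psi>\<^sub>A a))) (?\<phi> m)
        + coset_scale (tensor_null s\<^sub>M s\<^sub>A) lam (tensor s\<^sub>M s\<^sub>A (\<alpha>\<^sub>M (\<omega>\<^sub>M m)) (\<beta>\<^sub>A (\<psi>\<^sub>A a)))"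
      by (simp add: H.phi_ract twists split quot lins tensor_map_tensor[of s\<^sub>M _ _ s\<^sub>A] commutes)
    have "tensor_map s\<^sub>M s\<^sub>A \<omega>\<^sub>M \<psi>\<^sub>A (tensor_map s\<^sub>M s\<^sub>A (lact (\<alpha>\<^sub>A a)) id (tensor_map s\<^sub>M s\<^sub>A \<beta>\<^sub>M \<beta>\<^sub>A (\<phi> m))) =
        tensor_map s\<^sub>M s\<^sub>A (\<lambda>y. lact (\<alpha>\<^sub>A (\<omega>\<^sub>A a)) (\<beta>\<^sub>M y)) \<beta>\<^sub>A (tensor_map s\<^sub>M s\<^sub>A \<omega>\<^sub>M \<psi>\<^sub>A (\<phi> m))"
      by (rule tensor_map_comp3_eq_comp2[OF mem(3)]; simp add: lins lact commutes)
    then show "?\<phi> (lact (\<alpha>\<^sub>A a) (\<beta>\<^sub>M m)) =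
        tensor_map s\<^sub>M s\<^sub>A (\<lambda>y. lact (\<alpha>\<^sub>A (\<omega>\<^sub>A a)) (\<beta>\<^sub>M y)) \<beta>\<^sub>A (?\<phi> m)"
      by (simp add: H.phi_lact twists)
    have "tensor_map s\<^sub>A s\<^sub>M \<omega>\<^sub>A \<psi>\<^sub>M
          (tensor_map s\<^sub>A s\<^sub>M id (\<lambda>x. ract x (\<beta>\<^sub>A a)) (tensor_map s\<^sub>A s\<^sub>M \<alpha>\<^sub>A \<alpha>\<^sub>M (\<rho> m))) =
        tensor_map s\<^sub>A s\<^sub>M \<alpha>\<^sub>A (\<lambda>x. ract (\<alpha>\<^sub>M x) (\<beta>\<^sub>A (\<psi>\<^sub>A a))) (tensor_map s\<^sub>A s\<^sub>M \<omega>\<^sub>A \<psi>\<^sub>M (\<rho> m))"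
      by (rule tensor_map_comp3_eq_comp2[OF mem(2)]; simp add: lins ract commutes)
    then show "?\<rho> (ract (\<alpha>\<^sub>M m) (\<beta>\<^sub>A a)) =
        tensor_map s\<^sub>A s\<^sub>M \<alpha>\<^sub>A (\<lambda>x. ract (\<alpha>\<^sub>M x) (\<beta>\<^sub>A (\<psi>\<^sub>A a))) (?\<rho> m)"
      by (simp add: H.rho_ract twists)
  qed
qed

end
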